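(* If $\delta\approx h^2$ is sufficiently small, then the solution of the Crank-Nicolson system is unique; that is, for each $n=1,\dots,n_i$, the solution $\mathbf V^{(n)}=(V_1^{(n)},\dots,V_{n_e}^{(n)})\in(S_h^k)^{n_e}$ of $$\left(\frac{V_i^{(n)}-V_i^{(n-1)}}{\delta},W_i\right)+a_i\big(l(\hat V_1^{(n)}),\dots,l(\hat V_{n_e}^{(n)})\big)b_2^{(n-1/2)}\left(\frac{\partial\hat V_i^{(n)}}{\partial y},\frac{\partial W_i}{\partial y}\right)-\left(b_1^{(n-1/2)}\frac{\partial\hat V_i^{(n)}}{\partial y},W_i\right)=(g_i^{(n-1/2)},W_i)$$ for all $W_i\in S_h^k$, $i=1,\dots,n_e$, where $\hat V_i^{(n)}=\frac12(V_i^{(n)}+V_i^{(n-1)})$, is unique.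
   Context: Let $n_e\ge1$ be an integer and $T>0$. Let $\alpha,\beta\in\mathcal C^2([0,T])$ with $\alpha',\beta'\in L_2(]0,T[)$, put $\gamma=\beta-\alpha$, and assume $0<\gamma_0<\gamma(t)<\gamma_1<\infty$, $|\gamma'(t)|\le\gamma'_{\max}$ and $|\alpha'(t)|\le\alpha'_{\max}$ for all $t\in[0,T]$. Put $\Omega_t=]\alpha(t),\beta(t)[$ and $\Omega=]0,1[$. For $i=1,\dots,n_e$: $u_{i0}\in H_0^1(\Omega_0)$; $f_i$ satisfies $\int_0^T\int_{\Omega_t}f_i^2\,dx\,dt<\infty$; $a_i:\mathbb R^{n_e}\to\mathbb R^+$ is Lipschitz-continuous with $0<m_a\le a_i(s)\le M_a$ for all $s\in\mathbb R^{n_e}$. Notation: $b_1(y,t)=\dfrac{\alpha'(t)+\gamma'(t)y}{\gamma(t)}$, $b_2(t)=\dfrac1{\gamma(t)^2}$, $g_i(y,t)=f_i(\alpha(t)+\gamma(t)y,t)$, $v_{i0}(y)=u_{i0}(\alpha(0)+\gamma(0)y)$. Time is discretised with step $\delta>0$, $t_n=n\delta$, $n=0,\dots,n_i$, $T=n_i\delta$, and $t_{n-1/2}=\frac{t_n+t_{n-1}}2$. A superscript $(n-1/2)$ on a given function denotes its value at $t_{n-1/2}$. In the scheme, $l(w)=\gamma(t_{n-1/2})\int_0^1w(y)\,dy$. $(\cdot,\cdot)$ is the inner product of $L_2(\Omega)$. $\mathcal T_h$ is a partition of $\Omega$ into disjoint intervals of maximal length $h$; $S_h^k$ is the space of continuous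 functions on $[0,1]$ that vanish at $0$ and $1$ and are polynomials of degree $k$ on each interval of $\mathcal T_h$; $I_h$ is the Lagrange interpolation operator onto $S_h^k$. The scheme starts from $V_i^{(0)}=I_hv_{i0}$, and $\mathbf V^{(n-1)}$ is given by the previous steps. The scheme discretises, for $i=1,\dots,n_e$, the problem $\partial_tv_i-a_i(\lambda(v_1),\dots,\lambda(v_{n_e}))\,b_2\,\partial_y^2v_i-b_1\partial_yv_i=g_i$ in $]0,1[\times]0,T[$, $v_i(0,t)=v_i(1,t)=0$, $v_i(\cdot,0)=v_{i0}$, where $\lambda(v)=\gamma(t)\int_0^1v(y,t)\,dy$.
   Formalization: The midpoint values of g_i are assumed to lie in L_2(0,1) with discrete space-time L_2 norm bounded by a number G, on which the smallness of δ may depend; for f_i merely in L_2 of space-time these values are uncontrolled and uniqueness can fail. *)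

theory Defs
  imports "HOL-Analysis.Analysis"
begin

section \<open>Function spaces\<close>

definition L2_on :: "'a::euclidean_space set \<Rightarrow> ('a \<Rightarrow> real) \<Rightarrow> bool" where
  "L2_on A f \<longleftrightarrow> set_borel_measurable lebesgue A f \<and> set_integrable lebesgue A (\<lambda>x. (f x)\<^sup>2)"

definition test_function :: "real set \<Rightarrow> (real \<Rightarrow> real) \<Rightarrow> bool" where
  "test_function U \<phi> \<longleftrightarrow>
     (\<forall>n x. (deriv ^^ n) \<phi> differentiable (at x)) \<and>
     compact (closure {x. \<phi> x \<noteq> 0}) \<and> closure {x. \<phi> x \<noteq> 0} \<subseteq> U"

definition weak_deriv :: "real set \<Rightarrow> (real \<Rightarrow> real) \<Rightarrow> (real \<Rightarrow> real) \<Rightarrow> bool" where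
  "weak_deriv U u u' \<longleftrightarrow>
     (\<forall>\<phi>. test_function U \<phi> \<longrightarrow>
        (LINT x:U|lebesgue. u x * deriv \<phi> x) = - (LINT x:U|lebesgue. u' x * \<phi> x))"

text \<open>\<open>H\<^sub>0\<^sup>1(U)\<close> is the closure of the test functions in \<open>H\<^sup>1(U)\<close>. Membership is a property
  of the equivalence class of \<open>u\<close> modulo null sets; where point values of \<open>u\<close> matter, its
  continuous representative has to be selected in addition.\<close>

definition H01_on :: "real set \<Rightarrow> (real \<Rightarrow> real) \<Rightarrow> bool" where
  "H01_on U u \<longleftrightarrow> L2_on U u \<and>
     (\<exists>u'. L2_on U u' \<and> weak_deriv U u u' \<and>
        (\<exists>\<phi>. (\<forall>j::nat. test_function U (\<phi> j)) \<and>
             (\<lambda>j. (LINT x:U|lebesgue. (\<phi> j x - u x)\<^sup>2) + (LINT x:U|lebesgue. (deriv (\<phi> j) x - u' x)\<^sup>2))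
               \<longlonglongrightarrow> 0))"

definition C2_on :: "real set \<Rightarrow> (real \<Rightarrow> real) \<Rightarrow> bool" where
  "C2_on S \<phi> \<longleftrightarrow>
     (\<exists>\<phi>' \<phi>''. (\<forall>t\<in>S. (\<phi> has_real_derivative \<phi>' t) (at t within S)) \<and>
             (\<forall>t\<in>S. (\<phi>' has_real_derivative \<phi>'' t) (at t within S)) \<and>
             continuous_on S \<phi>'')"

text \<open>Derivative on the time interval, one-sided at its end points.\<close>

definition ddt :: "real \<Rightarrow> (real \<Rightarrow> real) \<Rightarrow> real \<Rightarrow> real" where
  "ddt T \<phi> t = vector_derivative \<phi> (at t within {0..T})"

section \<open>The problem transformed to the fixed domain\<close>

definition space_time_domain :: "real \<Rightarrow> (real \<Rightarrow> real) \<Rightarrow> (real \<Rightarrow> real) \<Rightarrow> (real \<times> real) set" where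
  "space_time_domain T \<alpha> \<beta> = {(x, t). 0 < t \<and> t < T \<and> \<alpha> t < x \<and> x < \<beta> t}"

definition coeff_b1 :: "real \<Rightarrow> (real \<Rightarrow> real) \<Rightarrow> (real \<Rightarrow> real) \<Rightarrow> real \<Rightarrow> real \<Rightarrow> real" where
  "coeff_b1 T \<alpha> \<gamma> y t = (ddt T \<alpha> t + ddt T \<gamma> t * y) / \<gamma> t"

definition coeff_b2 :: "(real \<Rightarrow> real) \<Rightarrow> real \<Rightarrow> real" where
  "coeff_b2 \<gamma> t = 1 / (\<gamma> t)\<^sup>2"

definition rhs_g :: "(real \<Rightarrow> real) \<Rightarrow> (real \<Rightarrow> real) \<Rightarrow> (real \<Rightarrow> real \<Rightarrow> real) \<Rightarrow> real \<Rightarrow> real \<Rightarrow> real" where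
  "rhs_g \<alpha> \<gamma> f y t = f (\<alpha> t + \<gamma> t * y) t"

definition init_v :: "(real \<Rightarrow> real) \<Rightarrow> (real \<Rightarrow> real) \<Rightarrow> (real \<Rightarrow> real) \<Rightarrow> real \<Rightarrow> real" where
  "init_v \<alpha> \<gamma> u0 y = u0 (\<alpha> 0 + \<gamma> 0 * y)"

section \<open>Finite elements on the unit interval\<close>

text \<open>The mesh consists of the intervals between consecutive points \<open>z 0 < \<dots> < z m\<close>.\<close>

definition mesh :: "nat \<Rightarrow> (nat \<Rightarrow> real) \<Rightarrow> real \<Rightarrow> bool" where
  "mesh m z h \<longleftrightarrow> 1 \<le> m \<and> z 0 = 0 \<and> z m = 1 \<and> (\<forall>j<m. z j < z (Suc j)) \<and>
     h = Max ((\<lambda>j. z (Suc j) - z j) ` {..<m})"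

text \<open>Elements are functions on the whole real line of which only the values on \<open>[0,1]\<close> matter.\<close>

definition fe_space :: "nat \<Rightarrow> nat \<Rightarrow> (nat \<Rightarrow> real) \<Rightarrow> (real \<Rightarrow> real) set" where
  "fe_space k m z = {w. continuous_on {0..1} w \<and> w 0 = 0 \<and> w 1 = 0 \<and>
     (\<forall>j<m. \<exists>p::real poly. degree p \<le> k \<and> (\<forall>x\<in>{z j..z (Suc j)}. w x = poly p x))}"

text \<open>Relative positions of the \<open>k + 1\<close> Lagrange nodes in an element; \<open>\<xi> r = r / k\<close> is the
  equidistant choice.\<close>

definition reference_nodes :: "nat \<Rightarrow> (nat \<Rightarrow> real) \<Rightarrow> bool" where
  "reference_nodes k \<xi> \<longleftrightarrow> \<xi> 0 = 0 \<and> \<xi> k = 1 \<and> strict_mono_on {..k} \<xi>"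

text \<open>\<open>w = I\<^sub>h v\<close>, expressed by the conditions that determine \<open>w\<close> on \<open>[0,1]\<close>.\<close>

definition lagrange_interpolant ::
  "nat \<Rightarrow> (nat \<Rightarrow> real) \<Rightarrow> nat \<Rightarrow> (nat \<Rightarrow> real) \<Rightarrow> (real \<Rightarrow> real) \<Rightarrow> (real \<Rightarrow> real) \<Rightarrow> bool" where
  "lagrange_interpolant k \<xi> m z v w \<longleftrightarrow> w \<in> fe_space k m z \<and>
     (\<forall>j<m. \<forall>r\<le>k. w (z j + (z (Suc j) - z j) * \<xi> r) = v (z j + (z (Suc j) - z j) * \<xi> r))"

section \<open>The Crank-Nicolson scheme\<close>

definition L2_inner :: "(real \<Rightarrow> real) \<Rightarrow> (real \<Rightarrow> real) \<Rightarrow> real" where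
  "L2_inner v w = (LINT y:{0<..<1}|lebesgue. v y * w y)"

definition t_mid :: "real \<Rightarrow> nat \<Rightarrow> real" where
  "t_mid \<delta> n = (real n * \<delta> + (real n - 1) * \<delta>) / 2"

definition nonlocal_l :: "(real \<Rightarrow> real) \<Rightarrow> real \<Rightarrow> (real \<Rightarrow> real) \<Rightarrow> real" where
  "nonlocal_l \<gamma> t w = \<gamma> t * (LINT y:{0<..<1}|lebesgue. w y)"

text \<open>\<open>V\<close> solves the system of the \<open>n\<close>-th time step with predecessor \<open>V0\<close>. On the finitely many
  mesh points, where \<open>deriv\<close> of an element may be meaningless, the integrals do not see it.\<close>

definition cn_step ::
  "real \<Rightarrow> (real \<Rightarrow> real) \<Rightarrow> (real \<Rightarrow> real) \<Rightarrow> ('n::finite \<Rightarrow> real ^ 'n \<Rightarrow> real) \<Rightarrow>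
   ('n \<Rightarrow> real \<Rightarrow> real \<Rightarrow> real) \<Rightarrow> (real \<Rightarrow> real) set \<Rightarrow> real \<Rightarrow> nat \<Rightarrow>
   ('n \<Rightarrow> real \<Rightarrow> real) \<Rightarrow> ('n \<Rightarrow> real \<Rightarrow> real) \<Rightarrow> bool" where
  "cn_step T \<alpha> \<gamma> a g S \<delta> n V0 V \<longleftrightarrow>
     (let t = t_mid \<delta> n; Vh = (\<lambda>i y. (V i y + V0 i y) / 2) in
       (\<forall>i. V i \<in> S) \<and>
       (\<forall>i. \<forall>W\<in>S.
          L2_inner (\<lambda>y. (V i y - V0 i y) / \<delta>) W
          + a i (\<chi> j. nonlocal_l \<gamma> t (Vh j)) * coeff_b2 \<gamma> t * L2_inner (deriv (Vh i)) (deriv W)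
          - L2_inner (\<lambda>y. coeff_b1 T \<alpha> \<gamma> y t * deriv (Vh i) y) W
          = L2_inner (\<lambda>y. g i y t) W))"

text \<open>Square integrability over space-time says nothing about the values of the data at the
  midpoints, which form a null set, although the scheme only sees these values. The scheme needs
  them to lie in \<open>L\<^sub>2\<close>; their discrete space-time norm is what enters its stability estimate.\<close>

definition sampled_data_bound ::
  "('n::finite \<Rightarrow> real \<Rightarrow> real \<Rightarrow> real) \<Rightarrow> real \<Rightarrow> nat \<Rightarrow> real \<Rightarrow> bool" where
  "sampled_data_bound g \<delta> N G \<longleftrightarrow>
     (\<forall>n\<in>{1..N}. \<forall>i. L2_on {0<..<1} (\<lambda>y. g i y (t_mid \<delta> n))) \<and>
     (\<Sum>n=1..N. \<delta> * (\<Sum>i\<in>UNIV. LINT y:{0<..<1}|lebesgue. (g i y (t_mid \<delta> n))\<^sup>2)) \<le> G"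

end

theory Submission
  imports Defs
begin

text \<open>Testing the scheme with the difference quotient of the solution, and dividing by the
  diffusion coefficient (a scalar, as the nonlocal term does not depend on \<open>y\<close>), gives by a
  discrete Gronwall argument a bound on the \<open>H\<^sup>1\<close> seminorms of all iterates that is uniform in
  \<open>\<delta>\<close> and the mesh; the interpolation operator is \<open>H\<^sup>1\<close>-stable in one dimension, which bounds the
  start. The difference of two solutions of one step, used as test function, is then controlled by
  the Lipschitz term times this bound, and \<open>1/\<delta>\<close> wins for small \<open>\<delta>\<close>. On general meshes there is
  no inverse inequality, hence the detour through the \<open>H\<^sup>1\<close> bound.\<close>

section \<open>Square integrable functions\<close>

text \<open>Tested with the difference quotient, the diffusion term becomes a difference of squared
  gradient norms, and the squared norm of the quotient absorbs convection and data. The sum over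
  time telescopes only because the coefficient, which changes from step to step, is traded for one
  lower bound \<open>\<mu>\<close>. Subtracting two solutions \<open>X\<close> and \<open>Y\<close>
  leaves the change of coefficient times the gradient of just one of them, \<open>Y\<close>. Since
  \<open>Y\<close> solves the \<open>n\<close>-th step, it can be counted as the last iterate and
  inherits the bound of the others. The components are coupled only through their means, so the
  component with the largest difference controls every change of coefficient and closes the
  estimate. Interpolation reads point values, so the regularity of the initial value is carried by a
  monotone function \<open>F\<close> with \<open>(v y - v x)^2 <= (y - x) * (F y - F x)\<close>.
  This form survives the affine map to the unit interval and adds up over the elements.\<close>

lemma L2_onD:
  assumes "L2_on A f"
  shows L2_on_measurable: "set_borel_measurable lebesgue A f"
    and L2_on_square_integrable: "set_integrable lebesgue A (\<lambda>x. (f x)\<^sup>2)"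
  using assms by (auto simp: L2_on_def)

lemma set_borel_measurable_mult:
  fixes f g :: "'a \<Rightarrow> real"
  assumes "set_borel_measurable M A f" "set_borel_measurable M A g"
  shows "set_borel_measurable M A (\<lambda>x. f x * g x)"
proof -
  have "(\<lambda>x. (indicator A x *\<^sub>R f x) * (indicator A x *\<^sub>R g x)) \<in> borel_measurable M"
    using assms unfolding set_borel_measurable_def by (rule borel_measurable_times)
  also have "(\<lambda>x. (indicator A x *\<^sub>R f x) * (indicator A x *\<^sub>R g x))
      = (\<lambda>x. indicator A x *\<^sub>R (f x * g x))"
    by (auto simp: indicator_def)
  finally show ?thesis unfolding set_borel_measurable_def .
qed

lemma set_borel_measurable_lincomb:
  fixes f g :: "'a \<Rightarrow> real"
  assumes "set_borel_measurable M A f" "set_borel_measurable M A g"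
  shows "set_borel_measurable M A (\<lambda>x. c * f x + d * g x)"
proof -
  have "(\<lambda>x. c * (indicator A x *\<^sub>R f x) + d * (indicator A x *\<^sub>R g x)) \<in> borel_measurable M"
    using assms unfolding set_borel_measurable_def by measurable
  also have "(\<lambda>x. c * (indicator A x *\<^sub>R f x) + d * (indicator A x *\<^sub>R g x))
      = (\<lambda>x. indicator A x *\<^sub>R (c * f x + d * g x))"
    by (auto simp: indicator_def)
  finally show ?thesis unfolding set_borel_measurable_def .
qed

lemma set_integral_lincomb:
  fixes f g :: "'a \<Rightarrow> real"
  assumes "set_integrable M A f" "set_integrable M A g"
  shows "(LINT x:A|M. c * f x + d * g x) = c * (LINT x:A|M. f x) + d * (LINT x:A|M. g x)"
proof -
  have "set_integrable M A (\<lambda>x. c * f x)" "set_integrable M A (\<lambda>x. d * g x)"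
    using assms by simp_all
  from set_integral_add(2)[OF this] show ?thesis by simp
qed

lemma L2_on_mult_integrable:
  assumes "L2_on A f" "L2_on A g"
  shows "set_integrable lebesgue A (\<lambda>x. f x * g x)"
proof (rule set_integrable_bound)
  show "set_integrable lebesgue A (\<lambda>x. (f x)\<^sup>2 + (g x)\<^sup>2)"
    using assms by (intro set_integral_add L2_on_square_integrable)
  show "set_borel_measurable lebesgue A (\<lambda>x. f x * g x)"
    using assms by (intro set_borel_measurable_mult L2_on_measurable)
  have "\<bar>u * v\<bar> \<le> u\<^sup>2 + v\<^sup>2" for u v :: real
  proof -
    have "0 \<le> (u + v)\<^sup>2 + u\<^sup>2 + v\<^sup>2" "0 \<le> (u - v)\<^sup>2 + u\<^sup>2 + v\<^sup>2" by simp_all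
    thus ?thesis by (simp add: power2_sum power2_diff abs_le_iff)
  qed
  thus "AE x in lebesgue. x \<in> A \<longrightarrow> norm (f x * g x) \<le> norm ((f x)\<^sup>2 + (g x)\<^sup>2)"
    by (simp del: abs_mult)
qed

lemma L2_on_lincomb:
  assumes "L2_on A f" "L2_on A g"
  shows "L2_on A (\<lambda>x. c * f x + d * g x)"
proof -
  have "set_integrable lebesgue A
      (\<lambda>x. (c\<^sup>2 * (f x)\<^sup>2 + (2 * c * d) * (f x * g x)) + d\<^sup>2 * (g x)\<^sup>2)"
    by (intro set_integral_add set_integrable_mult_right L2_on_mult_integrable
        L2_on_square_integrable assms)
  also have "(\<lambda>x. (c\<^sup>2 * (f x)\<^sup>2 + (2 * c * d) * (f x * g x)) + d\<^sup>2 * (g x)\<^sup>2)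
      = (\<lambda>x. (c * f x + d * g x)\<^sup>2)"
    by (auto simp: power2_eq_square algebra_simps)
  finally show ?thesis
    using assms by (auto simp: L2_on_def intro: set_borel_measurable_lincomb)
qed

lemma L2_on_bounded_mult:
  assumes "set_borel_measurable lebesgue A b" "\<And>x. x \<in> A \<Longrightarrow> \<bar>b x\<bar> \<le> B" "L2_on A f"
  shows "L2_on A (\<lambda>x. b x * f x)"
  unfolding L2_on_def
proof
  show m: "set_borel_measurable lebesgue A (\<lambda>x. b x * f x)"
    using assms(1,3) by (intro set_borel_measurable_mult) (auto dest: L2_on_measurable)
  show "set_integrable lebesgue A (\<lambda>x. (b x * f x)\<^sup>2)"
  proof (rule set_integrable_bound)
    show "set_integrable lebesgue A (\<lambda>x. B\<^sup>2 * (f x)\<^sup>2)"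
      using assms by (intro set_integrable_mult_right L2_on_square_integrable)
    show "set_borel_measurable lebesgue A (\<lambda>x. (b x * f x)\<^sup>2)"
      using set_borel_measurable_mult[OF m m] by (simp add: power2_eq_square)
    show "AE x in lebesgue. x \<in> A \<longrightarrow> norm ((b x * f x)\<^sup>2) \<le> norm (B\<^sup>2 * (f x)\<^sup>2)"
      using assms(2) by (auto simp: power_mult_distrib abs_le_square_iff[symmetric]
          intro!: mult_right_mono AE_I2 order_trans[OF _ abs_ge_self])
  qed
qed

lemma L2_on_const:
  assumes "A \<in> lmeasurable"
  shows "L2_on A (\<lambda>_. c)"
  using assms unfolding L2_on_def set_borel_measurable_def set_integrable_def
  by (auto simp: fmeasurable_def intro!: integrable_scaleR_left integrable_real_indicator)

lemma L2_on_bounded: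
  assumes "A \<in> lmeasurable" "set_borel_measurable lebesgue A f" "\<And>x. x \<in> A \<Longrightarrow> \<bar>f x\<bar> \<le> B"
  shows "L2_on A f"
  using L2_on_bounded_mult[OF assms(2,3) L2_on_const[OF assms(1), of 1]] by simp

lemma L2_on_imp_integrable:
  assumes "A \<in> lmeasurable" "L2_on A f"
  shows "set_integrable lebesgue A f"
  using L2_on_mult_integrable[OF assms(2) L2_on_const[OF assms(1), of 1]] by simp

lemma set_integral_nonneg:
  fixes f :: "'a \<Rightarrow> real"
  assumes "\<And>x. x \<in> A \<Longrightarrow> 0 \<le> f x"
  shows "0 \<le> (LINT x:A|M. f x)"
  unfolding set_lebesgue_integral_def
  by (rule integral_nonneg_AE) (use assms in \<open>auto simp: indicator_def\<close>)

text \<open>The integral of \<open>(c * f + d * g)^2\<close> is a nonnegative quadratic form in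
  \<open>c\<close> and \<open>d\<close>. The set \<open>A\<close> is kept general because
  subintervals are needed later.\<close>

lemma L2_Cauchy_Schwarz:
  assumes "L2_on A f" "L2_on A g"
  shows "(LINT x:A|lebesgue. f x * g x)\<^sup>2
      \<le> (LINT x:A|lebesgue. (f x)\<^sup>2) * (LINT x:A|lebesgue. (g x)\<^sup>2)"
proof -
  let ?p = "LINT x:A|lebesgue. (f x)\<^sup>2" and ?q = "LINT x:A|lebesgue. (g x)\<^sup>2"
    and ?r = "LINT x:A|lebesgue. f x * g x"
  have *: "0 \<le> c\<^sup>2 * ?p + (2 * c * d) * ?r + d\<^sup>2 * ?q" for c d :: real
  proof -
    have "0 \<le> (LINT x:A|lebesgue. (c * f x + d * g x)\<^sup>2)"
      by (rule set_integral_nonneg) simp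
    also have "\<dots> = (LINT x:A|lebesgue. (c\<^sup>2 * (f x)\<^sup>2 + (2 * c * d) * (f x * g x)) + d\<^sup>2 * (g x)\<^sup>2)"
      by (auto simp: power2_eq_square algebra_simps)
    also have "\<dots> = (LINT x:A|lebesgue. 1 * (c\<^sup>2 * (f x)\<^sup>2 + (2 * c * d) * (f x * g x)) + d\<^sup>2 * (g x)\<^sup>2)"
      by simp
    also have "\<dots> = c\<^sup>2 * ?p + (2 * c * d) * ?r + d\<^sup>2 * ?q"
      by (subst set_integral_lincomb, (intro set_integral_add set_integrable_mult_right
          L2_on_mult_integrable L2_on_square_integrable assms)+,
          subst set_integral_lincomb, (intro set_integral_add set_integrable_mult_right
          L2_on_mult_integrable L2_on_square_integrable assms)+) simp
    finally show ?thesis .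
  qed
  have p: "0 \<le> ?p" by (rule set_integral_nonneg) simp
  show ?thesis
  proof (cases "?p = 0")
    case True
    \<comment> \<open>For \<open>?p = 0\<close> the form is linear in \<open>c\<close>; this choice
      makes it \<open>-(?q + 2) * ?r^2\<close>, which forces \<open>?r = 0\<close>.\<close>
    hence "0 \<le> - (2 * (?q + 1) * ?r) * ?r + ?r\<^sup>2 * ?q"
      using *[of "- (?q + 1)" ?r] by (simp add: algebra_simps)
    hence "(?q + 2) * ?r\<^sup>2 \<le> 0" by (simp add: power2_eq_square algebra_simps)
    moreover have "0 \<le> ?q" by (rule set_integral_nonneg) simp
    ultimately have "?r\<^sup>2 \<le> 0" by (simp add: mult_le_0_iff)
    with True show ?thesis by simp
  next
    case False
    have "0 \<le> ?p * (?p * ?q - ?r\<^sup>2)"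
      using *[of "- ?r" ?p] by (simp add: power2_eq_square algebra_simps)
    with False p show ?thesis by (simp add: zero_le_mult_iff)
  qed
qed

lemma L2_inner_commute: "L2_inner f g = L2_inner g f"
  by (simp add: L2_inner_def mult.commute)

lemma L2_inner_self_nonneg: "0 \<le> L2_inner f f"
  unfolding L2_inner_def by (rule set_integral_nonneg) simp

lemma L2_inner_lincomb_left:
  assumes "L2_on {0<..<1} f" "L2_on {0<..<1} f'" "L2_on {0<..<1} g"
  shows "L2_inner (\<lambda>x. c * f x + d * f' x) g = c * L2_inner f g + d * L2_inner f' g"
proof -
  have "L2_inner (\<lambda>x. c * f x + d * f' x) g
      = (LINT x:{0<..<1}|lebesgue. c * (f x * g x) + d * (f' x * g x))"
    by (simp add: L2_inner_def algebra_simps)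
  also have "\<dots> = c * L2_inner f g + d * L2_inner f' g"
    unfolding L2_inner_def
    by (intro set_integral_lincomb L2_on_mult_integrable assms)
  finally show ?thesis .
qed

text \<open>Linearity of \<open>deriv\<close> on finite element functions holds only off the mesh
  points; this carries such identities into inner products.\<close>

lemma L2_inner_cong_finite:
  assumes "finite N" "\<And>x. x \<in> {0<..<1} - N \<Longrightarrow> f x = f' x" "\<And>x. x \<in> {0<..<1} - N \<Longrightarrow> g x = g' x"
  shows "L2_inner f g = L2_inner f' g'"
  unfolding L2_inner_def set_lebesgue_integral_def
  by (rule integral_discrete_difference[of N])
     (use assms in \<open>auto simp: indicator_def countable_finite\<close>)

lemma L2_inner_Cauchy_Schwarz:
  assumes "L2_on {0<..<1} f" "L2_on {0<..<1} g"
  shows "\<bar>L2_inner f g\<bar> \<le> sqrt (L2_inner f f) * sqrt (L2_inner g g)"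
  using L2_Cauchy_Schwarz[OF assms]
  by (simp add: L2_inner_def real_sqrt_mult[symmetric] power2_eq_square[symmetric] real_le_rsqrt)

section \<open>Finite element functions\<close>

lemma L2_on_finite_difference:
  fixes f :: "real \<Rightarrow> real"
  assumes "finite N" "L2_on (A - N) f"
  shows "L2_on A f"
  unfolding L2_on_def
proof
  show "set_borel_measurable lebesgue A f"
    unfolding set_borel_measurable_def
    by (rule measurable_discrete_difference[where X = N,
          OF L2_on_measurable[OF assms(2), unfolded set_borel_measurable_def]])
       (use assms(1) in \<open>auto simp: indicator_def countable_finite\<close>)
  show "set_integrable lebesgue A (\<lambda>x. (f x)\<^sup>2)"
    by (rule set_integrable_discrete_difference[where X = N, THEN iffD1,
          OF _ _ _ _ L2_on_square_integrable[OF assms(2)]])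
       (use assms(1) in \<open>auto simp: countable_finite\<close>)
qed

lemma set_borel_measurable_lebesgue_continuous_on:
  fixes f :: "real \<Rightarrow> real"
  assumes "A \<in> sets borel" "continuous_on A f"
  shows "set_borel_measurable lebesgue A f"
  using set_measurable_continuous_on[OF assms] unfolding set_borel_measurable_def
  by (intro measurable_completion) simp

lemma L2_on_bounded_continuous_on:
  fixes f :: "real \<Rightarrow> real"
  assumes "continuous_on {a..b} f"
  shows "L2_on {a<..<b} f"
proof -
  have "bounded (f ` {a..b})"
    by (intro compact_imp_bounded compact_continuous_image assms compact_Icc)
  then obtain B where "\<And>x. x \<in> {a..b} \<Longrightarrow> \<bar>f x\<bar> \<le> B" by (force simp: bounded_iff)
  thus ?thesis
    by (intro L2_on_bounded[of _ _ B] set_borel_measurable_lebesgue_continuous_on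
        continuous_on_subset[OF assms]) auto
qed

lemma mesh_mono:
  assumes "mesh m z h" "i \<le> j" "j \<le> m"
  shows "z i \<le> z j"
  using assms(2,3)
proof (induction j rule: dec_induct)
  case (step j)
  have "z j < z (Suc j)" using assms(1) step.prems by (auto simp: mesh_def)
  with step show ?case by auto
qed simp

lemma mesh_range:
  assumes "mesh m z h" "j \<le> m"
  shows "z j \<in> {0..1}"
  using mesh_mono[OF assms(1), of 0 j] mesh_mono[OF assms(1), of j m] assms by (auto simp: mesh_def)

text \<open>The induction finds the first mesh point to the right of \<open>x\<close>; as
  \<open>x\<close> is not a mesh point, the inequality on its left is strict.\<close>

lemma mesh_element:
  assumes "mesh m z h" "x \<in> {0<..<1}" "x \<notin> z ` {..m}"
  obtains j where "j < m" "z j < x" "x < z (Suc j)"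
proof -
  have "i \<le> m \<Longrightarrow> x < z i \<Longrightarrow> \<exists>j<m. z j < x \<and> x < z (Suc j)" for i
  proof (induction i)
    case 0
    thus ?case using assms by (auto simp: mesh_def)
  next
    case (Suc i)
    show ?case
    proof (cases "x < z i")
      case True
      with Suc show ?thesis by simp
    next
      case False
      with Suc assms(3) have "z i < x" by (force simp: not_less order_le_less)
      with Suc.prems show ?thesis by (intro exI[of _ i]) auto
    qed
  qed
  from this[of m] assms(1,2) that show ?thesis by (auto simp: mesh_def)
qed

lemma fe_space_lincomb:
  assumes "u \<in> fe_space k m z" "w \<in> fe_space k m z"
  shows "(\<lambda>x. c * u x + d * w x) \<in> fe_space k m z"
proof -
  have "\<exists>p. degree p \<le> k \<and> (\<forall>x\<in>{z j..z (Suc j)}. c * u x + d * w x = poly p x)" if "j < m" for j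
  proof -
    from assms that obtain p q
      where "degree p \<le> k" "\<forall>x\<in>{z j..z (Suc j)}. u x = poly p x"
        "degree q \<le> k" "\<forall>x\<in>{z j..z (Suc j)}. w x = poly q x"
      unfolding fe_space_def by blast
    thus ?thesis
      by (intro exI[of _ "smult c p + smult d q"])
         (auto intro!: degree_add_le order_trans[OF degree_smult_le])
  qed
  thus ?thesis using assms by (auto simp: fe_space_def intro!: continuous_intros)
qed

lemma fe_space_half_sum:
  assumes "u \<in> fe_space k m z" "w \<in> fe_space k m z"
  shows "(\<lambda>y. (u y + w y) / 2) \<in> fe_space k m z"
  using fe_space_lincomb[OF assms, of "1/2" "1/2"] by (simp add: add_divide_distrib)

lemma fe_space_has_derivative:
  assumes "w \<in> fe_space k m z" "j < m"
  obtains p where "degree p \<le> k" "\<And>x. x \<in> {z j..z (Suc j)} \<Longrightarrow> w x = poly p x"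
    "\<And>x. z j < x \<Longrightarrow> x < z (Suc j) \<Longrightarrow> (w has_real_derivative poly (pderiv p) x) (at x)"
proof -
  from assms obtain p where p: "degree p \<le> k" "\<forall>x\<in>{z j..z (Suc j)}. w x = poly p x"
    unfolding fe_space_def by blast
  have "(w has_real_derivative poly (pderiv p) x) (at x)" if "z j < x" "x < z (Suc j)" for x
  proof (rule has_field_derivative_transform_within_open)
    show "(poly p has_real_derivative poly (pderiv p) x) (at x)" by (rule poly_DERIV)
    show "open {z j<..<z (Suc j)}" by simp
  qed (use p that in auto)
  with p that show ?thesis by blast
qed

lemma fe_space_differentiable:
  assumes "mesh m z h" "w \<in> fe_space k m z" "x \<in> {0<..<1} - z ` {..m}"
  shows "(w has_real_derivative deriv w x) (at x)"
proof -
  from assms obtain j where "j < m" "z j < x" "x < z (Suc j)" by (auto elim: mesh_element)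
  with fe_space_has_derivative[OF assms(2)] show ?thesis by (metis DERIV_imp_deriv)
qed

lemma deriv_lincomb:
  assumes "mesh m z h" "u \<in> fe_space k m z" "w \<in> fe_space k m z" "x \<in> {0<..<1} - z ` {..m}"
  shows "deriv (\<lambda>x. c * u x + d * w x) x = c * deriv u x + d * deriv w x"
  by (intro DERIV_imp_deriv DERIV_add DERIV_cmult fe_space_differentiable[OF assms(1,2,4)]
      fe_space_differentiable[OF assms(1,3,4)])

lemma fe_space_L2:
  assumes "w \<in> fe_space k m z"
  shows "L2_on {0<..<1} w"
  using assms by (auto simp: fe_space_def intro: L2_on_bounded_continuous_on)

text \<open>Off the mesh points \<open>deriv w\<close> agrees locally with one of finitely many
  polynomials. It is therefore continuous there, hence measurable, and bounded by the sum of their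
  bounds on the unit interval.\<close>

lemma fe_space_deriv_L2:
  assumes "mesh m z h" "w \<in> fe_space k m z"
  shows "L2_on {0<..<1} (deriv w)"
proof (rule L2_on_finite_difference)
  let ?N = "z ` {..m}"
  show "finite ?N" by simp
  have "\<forall>j<m. \<exists>p. \<forall>x. z j < x \<and> x < z (Suc j) \<longrightarrow> deriv w x = poly (pderiv p) x"
    using fe_space_has_derivative[OF assms(2)] by (metis DERIV_imp_deriv)
  then obtain p where p: "\<And>j x. j < m \<Longrightarrow> z j < x \<Longrightarrow> x < z (Suc j) \<Longrightarrow> deriv w x = poly (pderiv (p j)) x"
    by metis
  have "\<exists>B. \<forall>x\<in>{0..1}. \<bar>poly (pderiv (p j)) x\<bar> \<le> B" for j
  proof -
    have "bounded (poly (pderiv (p j)) ` {0..1::real})"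
      by (intro compact_imp_bounded compact_continuous_image continuous_intros compact_Icc)
    thus ?thesis by (auto simp: bounded_iff)
  qed
  then obtain B where B: "\<And>j x. x \<in> {0..1} \<Longrightarrow> \<bar>poly (pderiv (p j)) x\<bar> \<le> B j" by metis
  have "open ({0<..<1} - ?N)" by (intro open_Diff finite_imp_closed) auto
  show "L2_on ({0<..<1} - ?N) (deriv w)"
  proof (rule L2_on_bounded)
    show "{0<..<1} - ?N \<in> lmeasurable"
      by (intro fmeasurable.Diff lmeasurable_interval lmeasurable_compact finite_imp_compact) auto
    show "\<bar>deriv w x\<bar> \<le> (\<Sum>j<m. B j)" if x: "x \<in> {0<..<1} - ?N" for x
    proof -
      from x obtain j where j: "j < m" "z j < x" "x < z (Suc j)"
        using mesh_element[OF assms(1)] by auto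
      have "\<bar>deriv w x\<bar> \<le> B j" using B[of x j] x p[OF j] by auto
      also have "\<dots> \<le> (\<Sum>j<m. B j)"
        using j B[of 0] by (intro member_le_sum) (auto intro: order_trans[OF abs_ge_zero])
      finally show ?thesis .
    qed
    have "isCont (deriv w) x" if x: "x \<in> {0<..<1} - ?N" for x
    proof -
      from x obtain j where j: "j < m" "z j < x" "x < z (Suc j)"
        using mesh_element[OF assms(1)] by auto
      have "eventually (\<lambda>y. y \<in> {z j<..<z (Suc j)}) (nhds x)"
        using j by (intro eventually_nhds_in_open) auto
      hence "eventually (\<lambda>y. deriv w y = poly (pderiv (p j)) y) (nhds x)"
        by eventually_elim (use j p in auto)
      thus ?thesis by (subst isCont_cong) auto
    qed
    hence "continuous_on ({0<..<1} - ?N) (deriv w)" by (intro continuous_at_imp_continuous_on) blast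
    thus "set_borel_measurable lebesgue ({0<..<1} - ?N) (deriv w)"
      using \<open>open _\<close> by (intro set_borel_measurable_lebesgue_continuous_on) auto
  qed
qed

lemma L2_inner_deriv_lincomb:
  assumes "mesh m z h" "u \<in> fe_space k m z" "w \<in> fe_space k m z" "L2_on {0<..<1} g"
  shows "L2_inner (deriv (\<lambda>x. c * u x + d * w x)) g = c * L2_inner (deriv u) g + d * L2_inner (deriv w) g"
proof -
  have "L2_inner (deriv (\<lambda>x. c * u x + d * w x)) g = L2_inner (\<lambda>x. c * deriv u x + d * deriv w x) g"
    by (rule L2_inner_cong_finite[of "z ` {..m}"]) (use deriv_lincomb[OF assms(1-3)] in auto)
  also have "\<dots> = c * L2_inner (deriv u) g + d * L2_inner (deriv w) g"
    by (intro L2_inner_lincomb_left fe_space_deriv_L2[OF assms(1,2)]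
        fe_space_deriv_L2[OF assms(1,3)] assms(4))
  finally show ?thesis .
qed

text \<open>Continuity up to the end points turns equality almost everywhere into equality at every
  point; this is how a norm estimate yields uniqueness of values.\<close>

lemma fe_space_norm_zero:
  assumes "w \<in> fe_space k m z" "L2_inner w w = 0" "x \<in> {0..1}"
  shows "w x = 0"
proof -
  have c: "continuous_on {0..1} w" using assms(1) by (simp add: fe_space_def)
  have "((\<lambda>x. w x * w x) has_integral 0) {0<..<1}"
    using has_integral_set_lebesgue[OF L2_on_mult_integrable[OF fe_space_L2[OF assms(1)] fe_space_L2[OF assms(1)]]]
      assms(2) by (simp add: L2_inner_def)
  hence "((\<lambda>x. w x * w x) has_integral 0) (cbox 0 1)"
    using has_integral_open_interval[of "\<lambda>x. w x * w x" 0 0 1] by simp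
  hence "w x * w x = 0"
    using c assms(3)
    by (intro has_integral_0_cbox_imp_0[where f = "\<lambda>x. w x * w x" and a = 0 and b = 1])
       (auto intro!: continuous_intros)
  thus ?thesis by simp
qed

section \<open>Energy and uniqueness estimates for one time step\<close>

lemma L2_inner_lincomb_self:
  assumes "L2_on {0<..<1} f" "L2_on {0<..<1} g"
  shows "L2_inner (\<lambda>x. c * f x + d * g x) (\<lambda>x. p * f x + q * g x)
    = c * p * L2_inner f f + (c * q + d * p) * L2_inner f g + d * q * L2_inner g g"
  by (subst L2_inner_lincomb_left, (intro assms L2_on_lincomb)+,
      subst (1 2) L2_inner_commute,
      subst (1 2) L2_inner_lincomb_left, (intro assms)+)
     (simp add: L2_inner_commute[of g f] algebra_simps)

text \<open>Convexity of the square. The scheme sees only the half sum, whereas the energy estimates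
  count the iterates themselves.\<close>

lemma deriv_average_norm:
  assumes mesh: "mesh m z h" and v: "v \<in> fe_space k m z" and u: "u \<in> fe_space k m z"
  shows "L2_inner (deriv (\<lambda>y. (v y + u y) / 2)) (deriv (\<lambda>y. (v y + u y) / 2))
    \<le> (L2_inner (deriv v) (deriv v) + L2_inner (deriv u) (deriv u)) / 2"
proof -
  let ?a = "\<lambda>y. (v y + u y) / 2"
  have a_def: "?a = (\<lambda>y. (1/2) * v y + (1/2) * u y)" by (simp add: add_divide_distrib)
  have dv: "L2_on {0<..<1} (deriv v)" and du: "L2_on {0<..<1} (deriv u)"
    using fe_space_deriv_L2[OF mesh] v u by blast+
  have "L2_inner (deriv ?a) (deriv ?a) = L2_inner (\<lambda>y. (1/2) * deriv v y + (1/2) * deriv u y)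
      (\<lambda>y. (1/2) * deriv v y + (1/2) * deriv u y)"
    unfolding a_def
    by (rule L2_inner_cong_finite[of "z ` {..m}"], simp) (rule deriv_lincomb[OF mesh v u]; assumption)+
  also have "\<dots> = (L2_inner (deriv v) (deriv v) + L2_inner (deriv u) (deriv u)) / 4 + L2_inner (deriv v) (deriv u) / 2"
    by (subst L2_inner_lincomb_self[OF dv du]) (simp add: field_simps)
  also have "L2_inner (deriv v) (deriv u) \<le> (L2_inner (deriv v) (deriv v) + L2_inner (deriv u) (deriv u)) / 2"
  proof -
    have "0 \<le> L2_inner (\<lambda>y. 1 * deriv v y + (-1) * deriv u y) (\<lambda>y. 1 * deriv v y + (-1) * deriv u y)"
      by (rule L2_inner_self_nonneg)
    thus ?thesis by (subst (asm) L2_inner_lincomb_self[OF dv du]) simp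
  qed
  finally show ?thesis by simp
qed

text \<open>With \<open>W\<close> the difference quotient, the time term is a squared norm and the
  diffusion term a difference of energies. \<open>\<kappa>\<close> stands for the diffusion
  coefficient frozen at this step, \<open>\<mu>\<close> for a bound shared by all steps.\<close>

lemma energy_step:
  fixes \<kappa> \<mu> \<delta> B :: real
  assumes mesh: "mesh m z h" and v: "v \<in> fe_space k m z" and u: "u \<in> fe_space k m z"
    and b: "continuous_on {0..1} b" "\<And>y. y \<in> {0<..<1} \<Longrightarrow> \<bar>b y\<bar> \<le> B"
    and g: "L2_on {0<..<1} g" and pos: "0 < \<mu>" "\<mu> \<le> \<kappa>" "0 < \<delta>"
    and eq: "\<And>W. W \<in> fe_space k m z \<Longrightarrow>
      L2_inner (\<lambda>y. (v y - u y) / \<delta>) W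
      + \<kappa> * L2_inner (deriv (\<lambda>y. (v y + u y) / 2)) (deriv W)
      - L2_inner (\<lambda>y. b y * deriv (\<lambda>y. (v y + u y) / 2) y) W = L2_inner g W"
  shows "\<mu> * (L2_inner (deriv v) (deriv v) - L2_inner (deriv u) (deriv u))
    \<le> \<delta> * (B\<^sup>2 / 2 * (L2_inner (deriv v) (deriv v) + L2_inner (deriv u) (deriv u)) + L2_inner g g)"
proof -
  let ?U = "{0<..<1::real}" and ?a = "\<lambda>y. (v y + u y) / 2" and ?w = "\<lambda>y. (v y - u y) / \<delta>"
  let ?E = "L2_inner (deriv v) (deriv v)" and ?E' = "L2_inner (deriv u) (deriv u)"
  have w_def: "?w = (\<lambda>y. (1/\<delta>) * v y + (-1/\<delta>) * u y)" by (simp add: diff_divide_distrib)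
  have a_def: "?a = (\<lambda>y. (1/2) * v y + (1/2) * u y)" by (simp add: add_divide_distrib)
  have w: "?w \<in> fe_space k m z" unfolding w_def by (intro fe_space_lincomb v u)
  have a: "?a \<in> fe_space k m z" by (intro fe_space_half_sum v u)
  have dv: "L2_on ?U (deriv v)" and du: "L2_on ?U (deriv u)"
    and dw: "L2_on ?U (deriv ?w)" and da: "L2_on ?U (deriv ?a)"
    using fe_space_deriv_L2[OF mesh] v u w a by blast+
  have wL2: "L2_on ?U ?w" by (rule fe_space_L2[OF w])
  have ba: "L2_on ?U (\<lambda>y. b y * deriv ?a y)"
    by (rule L2_on_bounded_mult[OF _ b(2) da])
       (auto intro!: set_borel_measurable_lebesgue_continuous_on continuous_on_subset[OF b(1)])
  have pw: "(1 * (b y * deriv ?a y * ?w y) + 1 * (g y * ?w y)) + (-1) * (?w y * ?w y)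
      \<le> B\<^sup>2 / 2 * (deriv ?a y * deriv ?a y) + (1/2) * (g y * g y)" if "y \<in> ?U" for y
  proof -
    define P Q R where "P = b y * deriv ?a y" and "Q = g y" and "R = ?w y"
    have "0 \<le> (P - Q)\<^sup>2 + (P + Q - 2 * R)\<^sup>2" by simp
    \<comment> \<open>The sum of squares equals
      \<open>2 * P^2 + 2 * Q^2 - 4 * (P * R + Q * R - R * R)\<close>: the time term
      \<open>R * R\<close> absorbs both products.\<close>
    hence "P * R + Q * R - R * R \<le> P\<^sup>2 / 2 + Q * Q / 2"
      by (simp add: power2_eq_square algebra_simps)
    moreover have "P\<^sup>2 \<le> B\<^sup>2 * (deriv ?a y * deriv ?a y)"
      unfolding P_def power_mult_distrib power2_eq_square[of "deriv ?a y", symmetric]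
      using b(2)[OF that] by (intro mult_right_mono) (auto simp: abs_le_square_iff[symmetric])
    ultimately show ?thesis by (simp add: P_def Q_def R_def)
  qed
  have "(L2_inner (\<lambda>y. b y * deriv ?a y) ?w + L2_inner g ?w) - L2_inner ?w ?w
      = (LINT y:?U|lebesgue. 1 * (1 * (b y * deriv ?a y * ?w y) + 1 * (g y * ?w y)) + (-1) * (?w y * ?w y))"
    unfolding L2_inner_def
    by (subst set_integral_lincomb, (intro set_integral_add(1) set_integrable_mult_right
          L2_on_mult_integrable ba wL2 g)+,
        subst set_integral_lincomb, (intro L2_on_mult_integrable ba wL2 g)+) simp
  also have "\<dots> = (LINT y:?U|lebesgue. (1 * (b y * deriv ?a y * ?w y) + 1 * (g y * ?w y)) + (-1) * (?w y * ?w y))"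
    by simp
  also have "\<dots> \<le> (LINT y:?U|lebesgue. B\<^sup>2 / 2 * (deriv ?a y * deriv ?a y) + (1/2) * (g y * g y))"
    by (rule set_integral_mono[OF _ _ pw])
       (intro set_integral_add(1) set_integrable_mult_right L2_on_mult_integrable ba wL2 g da; assumption)+
  also have "\<dots> = B\<^sup>2 / 2 * L2_inner (deriv ?a) (deriv ?a) + (1/2) * L2_inner g g"
    unfolding L2_inner_def by (intro set_integral_lincomb L2_on_mult_integrable da g)
  finally have rhs: "L2_inner (\<lambda>y. b y * deriv ?a y) ?w + L2_inner g ?w - L2_inner ?w ?w
      \<le> B\<^sup>2 / 2 * L2_inner (deriv ?a) (deriv ?a) + (1/2) * L2_inner g g" .
  have N: "finite (z ` {..m})" by simp
  \<comment> \<open>Half sum against difference: the mixed terms cancel. This is where the averaging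
    of Crank-Nicolson enters.\<close>
  have aw: "L2_inner (deriv ?a) (deriv ?w) = (?E - ?E') / (2 * \<delta>)"
  proof -
    have "L2_inner (deriv ?a) (deriv ?w) = L2_inner (\<lambda>y. (1/2) * deriv v y + (1/2) * deriv u y)
        (\<lambda>y. (1/\<delta>) * deriv v y + (-1/\<delta>) * deriv u y)"
      unfolding w_def a_def
      by (rule L2_inner_cong_finite[OF N]) (rule deriv_lincomb[OF mesh v u]; assumption)+
    also have "\<dots> = (?E - ?E') / (2 * \<delta>)"
      using pos unfolding L2_inner_lincomb_self[OF dv du, of "1/2" "1/2" "1/\<delta>" "-1/\<delta>"]
      by (simp add: field_simps)
    finally show ?thesis .
  qed
  have aa: "L2_inner (deriv ?a) (deriv ?a) \<le> (?E + ?E') / 2"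
    by (rule deriv_average_norm[OF mesh v u])
  have "\<kappa> * ((?E - ?E') / (2 * \<delta>)) \<le> B\<^sup>2 / 2 * L2_inner (deriv ?a) (deriv ?a) + (1/2) * L2_inner g g"
    using eq[OF w] rhs aw by simp
  also have "\<dots> \<le> B\<^sup>2 / 2 * ((?E + ?E') / 2) + (1/2) * L2_inner g g"
    using aa by (intro add_right_mono mult_left_mono) auto
  finally have *: "\<kappa> * (?E - ?E') \<le> \<delta> * (B\<^sup>2 / 2 * (?E + ?E') + L2_inner g g)"
    using pos by (simp add: field_simps)
  show ?thesis
  \<comment> \<open>Replacing \<open>\<kappa>\<close> by \<open>\<mu>\<close> is monotone only if
    the energy grows; if it does not, the left side is nonpositive and the right side
    nonnegative.\<close>
  proof (cases "?E \<le> ?E'")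
    case True
    hence "\<mu> * (?E - ?E') \<le> 0" using pos by (simp add: mult_le_0_iff)
    also have "0 \<le> \<delta> * (B\<^sup>2 / 2 * (?E + ?E') + L2_inner g g)"
      using pos by (intro mult_nonneg_nonneg add_nonneg_nonneg L2_inner_self_nonneg) auto
    finally show ?thesis .
  next
    case False
    hence "\<mu> * (?E - ?E') \<le> \<kappa> * (?E - ?E')" using pos by (intro mult_right_mono) auto
    with * show ?thesis by linarith
  qed
qed

text \<open>Part of the growth sits at the new time, so \<open>1 - s\<close> has to be inverted:
  \<open>1 / (1 - s) <= 1 + 2 * s\<close> for \<open>s <= 1/2\<close>. The 3 comes from
  \<open>(1 + 2 * s) * (1 + s) <= exp (3 * s)\<close>.\<close>

lemma discrete_Gronwall:
  fixes x \<eta> :: "nat \<Rightarrow> real"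
  assumes "0 \<le> s" "s \<le> 1 / 2" "\<And>q. 0 \<le> x q" "\<And>q. 0 \<le> \<eta> q"
    and "\<And>q. q < n \<Longrightarrow> x (Suc q) - x q \<le> s * (x (Suc q) + x q) + \<eta> (Suc q)"
  shows "x n \<le> exp (3 * s * real n) * (x 0 + (\<Sum>q=1..n. \<eta> q))"
  using assms(5)
proof (induction n)
  case (Suc n)
  let ?S = "x 0 + (\<Sum>q=1..n. \<eta> q)"
  have "1 + s \<le> exp s" "1 + 2 * s \<le> exp (2 * s)" by (rule exp_ge_add_one_self)+
  hence e: "(1 + 2 * s) * (1 + s) \<le> exp (3 * s)"
    using assms(1) mult_mono[of "1 + 2 * s" "exp (2 * s)" "1 + s" "exp s"]
    by (simp add: exp_add[symmetric])
  have e': "1 + 2 * s \<le> (1 + 2 * s) * (1 + s)" using assms(1) by (simp add: algebra_simps)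
  have "s * s \<le> s / 2" using assms(1,2) mult_left_mono[of s "1/2" s] by simp
  hence "1 \<le> (1 + 2 * s) * (1 - s)" by (simp add: algebra_simps)
  from mult_right_mono[OF this assms(3)[of "Suc n"]]
  have "x (Suc n) \<le> (1 + 2 * s) * (1 - s) * x (Suc n)" by simp
  also have "(1 - s) * x (Suc n) \<le> (1 + s) * x n + \<eta> (Suc n)"
    using Suc.prems[of n] by (simp add: algebra_simps)
  hence "(1 + 2 * s) * (1 - s) * x (Suc n) \<le> (1 + 2 * s) * ((1 + s) * x n + \<eta> (Suc n))"
    unfolding mult.assoc using assms(1) by (intro mult_left_mono) auto
  also have "\<dots> = (1 + 2 * s) * (1 + s) * x n + (1 + 2 * s) * \<eta> (Suc n)" by (simp add: algebra_simps)
  also have "\<dots> \<le> exp (3 * s) * x n + exp (3 * s) * \<eta> (Suc n)"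
    using e e' assms(3,4) by (intro add_mono mult_right_mono) auto
  also have "\<dots> \<le> exp (3 * s) * (exp (3 * s * real n) * ?S) + exp (3 * s) * (exp (3 * s * real n) * \<eta> (Suc n))"
  proof (intro add_mono mult_left_mono)
    show "x n \<le> exp (3 * s * real n) * ?S" using Suc by simp
    \<comment> \<open>The newest source has not grown yet; giving it the full factor puts all
      sources under one exponential.\<close>
    have "1 * \<eta> (Suc n) \<le> exp (3 * s * real n) * \<eta> (Suc n)"
      using assms(1,4) by (intro mult_right_mono) auto
    thus "\<eta> (Suc n) \<le> exp (3 * s * real n) * \<eta> (Suc n)" by simp
  qed auto
  also have "\<dots> = exp (3 * s * real (Suc n)) * (x 0 + (\<Sum>q=1..Suc n. \<eta> q))"
    by (simp add: algebra_simps exp_add)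
  finally show ?case .
qed simp

text \<open>The difference of the two half sums is \<open>(X - Y) / 2\<close>, and it serves as test
  function. \<open>F\<close> is left abstract because the right-hand sides cancel. \<open>D\<close>
  and \<open>K\<close> are separate because \<open>D\<close> will itself be proportional to the norm
  of the difference.\<close>

lemma uniqueness_estimate:
  fixes \<kappa> \<kappa>' \<mu> \<delta> B D K :: real
  assumes mesh: "mesh m z h" and X: "X \<in> fe_space k m z" and Y: "Y \<in> fe_space k m z"
    and u: "u \<in> fe_space k m z"
    and b: "continuous_on {0..1} b" "\<And>y. y \<in> {0<..<1} \<Longrightarrow> \<bar>b y\<bar> \<le> B"
    and pos: "0 < \<mu>" "\<mu> \<le> \<kappa>" "0 < \<delta>" and D: "\<bar>\<kappa> - \<kappa>'\<bar> \<le> D"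
    and K: "sqrt (L2_inner (deriv (\<lambda>y. (Y y + u y) / 2)) (deriv (\<lambda>y. (Y y + u y) / 2))) \<le> K"
    and eqX: "\<And>W. W \<in> fe_space k m z \<Longrightarrow>
      L2_inner (\<lambda>y. (X y - u y) / \<delta>) W
      + \<kappa> * L2_inner (deriv (\<lambda>y. (X y + u y) / 2)) (deriv W)
      - L2_inner (\<lambda>y. b y * deriv (\<lambda>y. (X y + u y) / 2) y) W = F W"
    and eqY: "\<And>W. W \<in> fe_space k m z \<Longrightarrow>
      L2_inner (\<lambda>y. (Y y - u y) / \<delta>) W
      + \<kappa>' * L2_inner (deriv (\<lambda>y. (Y y + u y) / 2)) (deriv W)
      - L2_inner (\<lambda>y. b y * deriv (\<lambda>y. (Y y + u y) / 2) y) W = F W"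
  shows "4 * \<mu> * L2_inner (\<lambda>y. (X y - Y y) / 2) (\<lambda>y. (X y - Y y) / 2)
    \<le> \<delta> * (D\<^sup>2 * K\<^sup>2 + B\<^sup>2 * L2_inner (\<lambda>y. (X y - Y y) / 2) (\<lambda>y. (X y - Y y) / 2))"
proof -
  let ?U = "{0<..<1::real}" and ?e = "\<lambda>y. (X y - Y y) / 2"
    and ?X = "\<lambda>y. (X y + u y) / 2" and ?Y = "\<lambda>y. (Y y + u y) / 2"
  have e_def: "?e = (\<lambda>y. 1 * ?X y + (-1) * ?Y y)" by (auto simp: field_simps)
  have hX: "?X \<in> fe_space k m z" and hY: "?Y \<in> fe_space k m z"
    by (intro fe_space_half_sum X Y u)+
  have e: "?e \<in> fe_space k m z" unfolding e_def by (intro fe_space_lincomb hX hY)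
  note de_eq = deriv_lincomb[OF mesh hX hY, of _ 1 "-1", folded e_def]
  have eL2: "L2_on ?U ?e" and XL2: "L2_on ?U X" and YL2: "L2_on ?U Y" and uL2: "L2_on ?U u"
    using fe_space_L2 e X Y u by blast+
  have dX: "L2_on ?U (deriv ?X)" and dY: "L2_on ?U (deriv ?Y)" and de: "L2_on ?U (deriv ?e)"
    using fe_space_deriv_L2[OF mesh] hX hY e by blast+
  have bL2: "L2_on ?U (\<lambda>y. b y * f y)" if "L2_on ?U f" for f
    by (rule L2_on_bounded_mult[OF _ b(2) that])
       (auto intro!: set_borel_measurable_lebesgue_continuous_on continuous_on_subset[OF b(1)])
  define p q where "p = sqrt (L2_inner ?e ?e)" and "q = sqrt (L2_inner (deriv ?e) (deriv ?e))"
  have p2: "p\<^sup>2 = L2_inner ?e ?e" and q2: "q\<^sup>2 = L2_inner (deriv ?e) (deriv ?e)"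
    and pq: "0 \<le> p" "0 \<le> q"
    by (simp_all add: p_def q_def L2_inner_self_nonneg)
  have 1: "L2_inner (\<lambda>y. (X y - u y) / \<delta>) ?e - L2_inner (\<lambda>y. (Y y - u y) / \<delta>) ?e = (2 / \<delta>) * p\<^sup>2"
  proof -
    have "L2_inner (\<lambda>y. (X y - u y) / \<delta>) ?e - L2_inner (\<lambda>y. (Y y - u y) / \<delta>) ?e
      = L2_inner (\<lambda>y. (1/\<delta>) * X y + (-1/\<delta>) * u y) ?e - L2_inner (\<lambda>y. (1/\<delta>) * Y y + (-1/\<delta>) * u y) ?e"
      by (simp add: diff_divide_distrib)
    also have "\<dots> = (1/\<delta>) * L2_inner X ?e + (-1/\<delta>) * L2_inner Y ?e"
      by (simp only: L2_inner_lincomb_left XL2 YL2 uL2 eL2)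
    also have "\<dots> = L2_inner (\<lambda>y. (1/\<delta>) * X y + (-1/\<delta>) * Y y) ?e"
      by (simp only: L2_inner_lincomb_left XL2 YL2 eL2)
    \<comment> \<open>The factor 2 undoes the halving in \<open>?e\<close>; the zero summand only
      gives the shape of \<open>L2_inner_lincomb_left\<close>.\<close>
    also have "\<dots> = L2_inner (\<lambda>y. (2/\<delta>) * ?e y + 0 * ?e y) ?e"
      by (simp add: diff_divide_distrib)
    also have "\<dots> = (2 / \<delta>) * p\<^sup>2"
      by (simp only: L2_inner_lincomb_left eL2 p2)
    finally show ?thesis .
  qed
  have 2: "L2_inner (deriv ?X) (deriv ?e) - L2_inner (deriv ?Y) (deriv ?e) = q\<^sup>2"
    using L2_inner_deriv_lincomb[OF mesh hX hY de, of 1 "-1", folded e_def] by (simp add: q2)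
  have 3: "L2_inner (\<lambda>y. b y * deriv ?X y) ?e - L2_inner (\<lambda>y. b y * deriv ?Y y) ?e
      = L2_inner (\<lambda>y. b y * deriv ?e y) ?e"
  proof -
    have "L2_inner (\<lambda>y. b y * deriv ?e y) ?e
        = L2_inner (\<lambda>y. 1 * (b y * deriv ?X y) + (-1) * (b y * deriv ?Y y)) ?e"
      by (rule L2_inner_cong_finite[of "z ` {..m}"]) (auto simp: de_eq algebra_simps)
    also have "\<dots> = L2_inner (\<lambda>y. b y * deriv ?X y) ?e - L2_inner (\<lambda>y. b y * deriv ?Y y) ?e"
      by (simp only: L2_inner_lincomb_left bL2 dX dY eL2)
    finally show ?thesis by simp
  qed
  have 4: "L2_inner (\<lambda>y. b y * deriv ?e y) ?e \<le> B * q * p"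
  proof -
    have "0 \<le> B" using b(2)[of "1/2"] by simp
    have "L2_inner (\<lambda>y. b y * deriv ?e y) ?e
        \<le> sqrt (L2_inner (\<lambda>y. b y * deriv ?e y) (\<lambda>y. b y * deriv ?e y)) * p"
      unfolding p_def using L2_inner_Cauchy_Schwarz[OF bL2[OF de] eL2] by linarith
    also have "L2_inner (\<lambda>y. b y * deriv ?e y) (\<lambda>y. b y * deriv ?e y) \<le> B\<^sup>2 * q\<^sup>2"
    proof -
      have "L2_inner (\<lambda>y. b y * deriv ?e y) (\<lambda>y. b y * deriv ?e y)
          \<le> (LINT y:?U|lebesgue. B\<^sup>2 * (deriv ?e y * deriv ?e y))"
        unfolding L2_inner_def
      proof (rule set_integral_mono)
        fix y :: real assume "y \<in> ?U"
        thus "b y * deriv ?e y * (b y * deriv ?e y) \<le> B\<^sup>2 * (deriv ?e y * deriv ?e y)"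
          unfolding power2_eq_square[symmetric] power_mult_distrib
          using b(2)[of y] by (intro mult_right_mono) (auto simp: abs_le_square_iff[symmetric])
      qed (intro set_integrable_mult_right L2_on_mult_integrable bL2 de)+
      thus ?thesis by (simp add: L2_inner_def q2)
    qed
    hence "sqrt (L2_inner (\<lambda>y. b y * deriv ?e y) (\<lambda>y. b y * deriv ?e y)) \<le> B * q"
      using \<open>0 \<le> B\<close> pq by (intro real_le_lsqrt) (auto simp: power_mult_distrib L2_inner_self_nonneg)
    finally show ?thesis using pq by (simp add: mult_right_mono)
  qed
  have 5: "- ((\<kappa> - \<kappa>') * L2_inner (deriv ?Y) (deriv ?e)) \<le> D * (K * q)"
  proof -
    have "\<bar>L2_inner (deriv ?Y) (deriv ?e)\<bar> \<le> K * q"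
      using L2_inner_Cauchy_Schwarz[OF dY de] mult_right_mono[OF K pq(2)] by (simp add: q_def)
    hence "\<bar>\<kappa> - \<kappa>'\<bar> * \<bar>L2_inner (deriv ?Y) (deriv ?e)\<bar> \<le> D * (K * q)"
      using D by (intro mult_mono) auto
    thus ?thesis by (simp add: abs_mult[symmetric])
  qed
  \<comment> \<open>Writing \<open>X'\<close>, \<open>Y'\<close>, \<open>e'\<close> for the
    gradients of \<open>?X\<close>, \<open>?Y\<close>, \<open>?e\<close>, the splitting is
    \<open>\<kappa> * X' - \<kappa>' * Y' = \<kappa> * e' + (\<kappa> - \<kappa>') * Y'\<close>, so
    only the gradient of \<open>?Y\<close> meets the change of coefficient.\<close>
  have "(2 / \<delta>) * p\<^sup>2 + \<kappa> * q\<^sup>2 + (\<kappa> - \<kappa>') * L2_inner (deriv ?Y) (deriv ?e) = L2_inner (\<lambda>y. b y * deriv ?e y) ?e"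
    using eqX[OF e] eqY[OF e] unfolding 1[symmetric] 2[symmetric] 3[symmetric] by (simp add: algebra_simps)
  moreover have "\<mu> * q\<^sup>2 \<le> \<kappa> * q\<^sup>2" using pos by (intro mult_right_mono) auto
  ultimately have "(2 / \<delta>) * p\<^sup>2 + \<mu> * q\<^sup>2 \<le> D * K * q + B * q * p"
    using 4 5 by simp
  hence "2 * \<mu> * ((2 / \<delta>) * p\<^sup>2 + \<mu> * q\<^sup>2) \<le> 2 * \<mu> * (D * K * q + B * q * p)"
    using pos by (intro mult_left_mono) auto
  \<comment> \<open>After multiplication by \<open>2 * \<mu>\<close> the diffusion term is
    \<open>2 * \<mu>^2 * q^2\<close>; each of the two squares uses up half of it, so
    \<open>q\<close> disappears.\<close>
  moreover have "0 \<le> (\<mu> * q - D * K)\<^sup>2 + (\<mu> * q - B * p)\<^sup>2" by simp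
  ultimately have "4 * \<mu> / \<delta> * p\<^sup>2 \<le> D\<^sup>2 * K\<^sup>2 + B\<^sup>2 * p\<^sup>2"
    by (simp add: power2_eq_square algebra_simps)
  thus ?thesis using pos by (simp add: p2 field_simps)
qed

section \<open>Regularity of the initial value\<close>

lemma test_function_derivs:
  assumes "test_function U \<phi>"
  shows "(\<phi> has_real_derivative deriv \<phi> x) (at x)" and "isCont (deriv \<phi>) x"
proof -
  have d: "(deriv ^^ n) \<phi> field_differentiable at x" for n
    using assms by (simp add: test_function_def field_differentiable_def real_differentiable_def
        real_differentiableE[unfolded has_field_derivative_def])
  from d[of 0] show "(\<phi> has_real_derivative deriv \<phi> x) (at x)"
    by (simp add: field_differentiable_derivI)
  from d[of 1] show "isCont (deriv \<phi>) x"
    by (simp add: field_differentiable_imp_continuous_at)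
qed

lemma test_function_zero:
  assumes "test_function {a<..<b} \<phi>" "x \<le> a"
  shows "\<phi> x = 0"
  using assms closure_subset[of "{x. \<phi> x \<noteq> 0}"] by (fastforce simp: test_function_def)

lemma L2_on_subset:
  assumes "L2_on A f" "B \<subseteq> A" "A \<in> sets lebesgue" "B \<in> sets lebesgue"
  shows "L2_on B f"
  unfolding L2_on_def
proof
  show "set_borel_measurable lebesgue B f"
    by (rule set_borel_measurable_subset[OF L2_on_measurable[OF assms(1)] assms(4,2)])
  show "set_integrable lebesgue B (\<lambda>x. (f x)\<^sup>2)"
    by (rule set_integrable_subset[OF L2_on_square_integrable[OF assms(1)] assms(4,2)])
qed

lemma set_integral_split:
  fixes f :: "real \<Rightarrow> real"
  assumes xy: "a \<le> x" "x \<le> y" "y \<le> b" and f: "set_integrable lebesgue {a<..<b} f"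
  shows "(LINT s:{a<..<y}|lebesgue. f s)
    = (LINT s:{a<..<x}|lebesgue. f s) + (LINT s:{x<..<y}|lebesgue. f s)"
proof -
  have "(LINT s:{a<..<y}|lebesgue. f s) = (LINT s:{a<..<x} \<union> {x<..<y}|lebesgue. f s)"
    by (rule set_integral_discrete_difference[where X = "{x}"]) (use xy in auto)
  also have "\<dots> = (LINT s:{a<..<x}|lebesgue. f s) + (LINT s:{x<..<y}|lebesgue. f s)"
    using xy by (intro set_integral_Un set_integrable_subset[OF f]) auto
  finally show ?thesis .
qed

text \<open>Let \<open>c\<close> be the defect between \<open>u\<close> and the primitive of
  \<open>u'\<close>. For test functions this defect is zero, and the approximation in the H1 norm
  makes the L2 norm of \<open>c\<close> vanish; by continuity \<open>c\<close> is zero at every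
  point, end points included.\<close>

lemma H01_on_absolutely_continuous:
  assumes H: "H01_on {a<..<b} u" and cont: "continuous_on {a..b} u" and "a < b"
  obtains u' where "L2_on {a<..<b} u'"
    "\<And>x. x \<in> {a..b} \<Longrightarrow> u x = (LINT s:{a<..<x}|lebesgue. u' s)"
proof -
  let ?U = "{a<..<b}"
  from H obtain u' \<phi> where u: "L2_on ?U u" and u': "L2_on ?U u'"
    and \<phi>: "\<And>j::nat. test_function ?U (\<phi> j)"
    and lim: "(\<lambda>j. (LINT x:?U|lebesgue. (\<phi> j x - u x)\<^sup>2) + (LINT x:?U|lebesgue. (deriv (\<phi> j) x - u' x)\<^sup>2)) \<longlonglongrightarrow> 0"
    unfolding H01_on_def by blast
  define c where "c x = u x - (LINT s:{a<..<x}|lebesgue. u' s)" for x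
  have \<phi>L2: "L2_on ?U (\<phi> j)" and d\<phi>L2: "L2_on ?U (deriv (\<phi> j))" for j
    using test_function_derivs[OF \<phi>]
    by (auto intro!: L2_on_bounded_continuous_on continuous_at_imp_continuous_on intro: DERIV_isCont)
  have diffL2: "L2_on ?U (\<lambda>x. \<phi> j x - u x)" "L2_on ?U (\<lambda>x. deriv (\<phi> j) x - u' x)" for j :: nat
    using L2_on_lincomb[OF \<phi>L2[of j] u, of 1 "-1"] L2_on_lincomb[OF d\<phi>L2[of j] u', of 1 "-1"] by simp_all
  have sub: "L2_on {a<..<x} f" if "x \<in> {a..b}" "L2_on ?U f" for x f
    by (rule L2_on_subset[OF that(2)]) (use that in auto)
  have si: "set_integrable lebesgue {a<..<x} f" if "x \<in> {a..b}" "L2_on ?U f" for x f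
    by (intro L2_on_imp_integrable sub[OF that]) auto
  have ftc: "\<phi> j x = (LINT s:{a<..<x}|lebesgue. deriv (\<phi> j) s)" if x: "x \<in> {a..b}" for j x
  proof -
    have "(deriv (\<phi> j) has_integral (\<phi> j x - \<phi> j a)) {a..x}"
      using x test_function_derivs(1)[OF \<phi>]
      by (intro fundamental_theorem_of_calculus)
         (auto simp: has_real_derivative_iff_has_vector_derivative[symmetric] intro: has_field_derivative_at_within)
    \<comment> \<open>The boundary term at \<open>a\<close> drops out because the support lies in
      the open interval.\<close>
    hence "integral {a<..<x} (deriv (\<phi> j)) = \<phi> j x"
      using test_function_zero[OF \<phi>, of a j] by (simp add: integral_open_interval_real[symmetric] integral_unique)
    thus ?thesis using set_lebesgue_integral_eq_integral(2)[OF si[OF x d\<phi>L2]] by simp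
  qed
  have cont_c: "continuous_on {a..b} c"
  proof -
    have "u' integrable_on {a..b}"
      using set_lebesgue_integral_eq_integral(1)[OF si[OF _ u']] \<open>a < b\<close>
      by (auto simp: integrable_on_open_interval_real[symmetric])
    hence cont_diff: "continuous_on {a..b} (\<lambda>x. u x - integral {a..x} u')"
      by (intro continuous_intros cont indefinite_integral_continuous_1)
    have "u x - integral {a..x} u' = c x" if "x \<in> {a..b}" for x
      using set_lebesgue_integral_eq_integral(2)[OF si[OF that u']]
      by (simp add: c_def integral_open_interval_real[symmetric])
    with cont_diff show ?thesis by (rule continuous_on_eq)
  qed
  let ?e = "\<lambda>j. (LINT x:?U|lebesgue. (\<phi> j x - u x)\<^sup>2)"
    and ?e' = "\<lambda>j. (LINT x:?U|lebesgue. (deriv (\<phi> j) x - u' x)\<^sup>2)"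
  have pw: "(c x)\<^sup>2 \<le> 2 * (\<phi> j x - u x)\<^sup>2 + 2 * (b - a) * ?e' j" if x: "x \<in> ?U" for x j
  proof -
    have x': "x \<in> {a..b}" using x by simp
    let ?r = "LINT s:{a<..<x}|lebesgue. deriv (\<phi> j) s - u' s"
    have "?r = \<phi> j x - (LINT s:{a<..<x}|lebesgue. u' s)"
      using set_integral_diff(2)[OF si[OF x' d\<phi>L2] si[OF x' u']] ftc[OF x'] by simp
    hence c: "c x = ?r - (\<phi> j x - u x)" by (simp add: c_def)
    \<comment> \<open>Cauchy-Schwarz against the constant 1, whose squared norm on the subinterval
      is \<open>x - a\<close>.\<close>
    have "?r\<^sup>2 \<le> (LINT s:{a<..<x}|lebesgue. (deriv (\<phi> j) s - u' s)\<^sup>2) * (x - a)"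
      using L2_Cauchy_Schwarz[OF sub[OF x' diffL2(2)[of j]] L2_on_const[of "{a<..<x}" 1]] x
      by (simp add: set_lebesgue_integral_def)
    also have "\<dots> \<le> ?e' j * (b - a)"
    proof (intro mult_mono set_integral_nonneg)
      show "(LINT s:{a<..<x}|lebesgue. (deriv (\<phi> j) s - u' s)\<^sup>2) \<le> ?e' j"
        using x set_integral_split[OF _ _ order_refl L2_on_square_integrable[OF diffL2(2)[of j]], of x]
        by (simp add: set_integral_nonneg)
    qed (use x in auto)
    finally have r: "?r\<^sup>2 \<le> ?e' j * (b - a)" .
    have "0 \<le> (?r + (\<phi> j x - u x))\<^sup>2" by simp
    hence "(c x)\<^sup>2 \<le> 2 * ?r\<^sup>2 + 2 * (\<phi> j x - u x)\<^sup>2"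
      unfolding c by (simp add: power2_eq_square algebra_simps)
    with r show ?thesis by (simp add: algebra_simps)
  qed
  have cL2: "L2_on ?U c" by (rule L2_on_bounded_continuous_on[OF cont_c])
  \<comment> \<open>The factor is a crude common bound for the coefficients 2 of \<open>?e j\<close>
    and \<open>2 * (b - a)^2\<close> of \<open>?e' j\<close>, so that \<open>lim\<close> applies to
    the plain sum.\<close>
  have le: "(LINT x:?U|lebesgue. (c x)\<^sup>2) \<le> (2 + 2 * (b - a)\<^sup>2) * (?e j + ?e' j)" for j
  proof -
    have "(LINT x:?U|lebesgue. (c x)\<^sup>2)
      \<le> (LINT x:?U|lebesgue. 2 * (\<phi> j x - u x)\<^sup>2 + (2 * (b - a) * ?e' j) * 1)"
      using pw L2_on_const[of ?U 1]
      by (intro set_integral_mono set_integral_add(1) set_integrable_mult_right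
          L2_on_square_integrable cL2 diffL2 L2_on_imp_integrable) auto
    also have "\<dots> = 2 * ?e j + (2 * (b - a) * ?e' j) * (LINT x:?U|lebesgue. 1)"
      using L2_on_const[of ?U 1]
      by (intro set_integral_lincomb L2_on_square_integrable diffL2 L2_on_imp_integrable) auto
    also have "(LINT x:?U|lebesgue. 1) = b - a"
      using \<open>a < b\<close> by (simp add: set_lebesgue_integral_def)
    also have "2 * ?e j + (2 * (b - a) * ?e' j) * (b - a)
        = (2 + 2 * (b - a)\<^sup>2) * (?e j + ?e' j) - (2 * (b - a)\<^sup>2 * ?e j + 2 * ?e' j)"
      by (simp add: power2_eq_square algebra_simps)
    also have "\<dots> \<le> (2 + 2 * (b - a)\<^sup>2) * (?e j + ?e' j)"
      by (intro diff_le_eq[THEN iffD2] le_add_same_cancel1[THEN iffD2] add_nonneg_nonneg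
          mult_nonneg_nonneg set_integral_nonneg) auto
    finally show ?thesis .
  qed
  have "(LINT x:?U|lebesgue. (c x)\<^sup>2) \<le> (2 + 2 * (b - a)\<^sup>2) * 0"
    by (rule LIMSEQ_le_const[OF tendsto_mult_left[OF lim]]) (use le in blast)
  hence "(LINT x:?U|lebesgue. (c x)\<^sup>2) = 0"
    using set_integral_nonneg[of ?U "\<lambda>x. (c x)\<^sup>2" lebesgue] by simp
  hence "((\<lambda>x. (c x)\<^sup>2) has_integral 0) (cbox a b)"
    using has_integral_set_lebesgue[OF L2_on_square_integrable[OF cL2]]
      has_integral_open_interval[of "\<lambda>x. (c x)\<^sup>2" 0 a b] by simp
  hence "(c x)\<^sup>2 = 0" if "x \<in> {a..b}" for x
    using cont_c \<open>a < b\<close> that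
    by (intro has_integral_0_cbox_imp_0[where f = "\<lambda>x. (c x)\<^sup>2" and a = a and b = b])
       (auto intro!: continuous_intros)
  with u' that[of u'] show ?thesis by (simp add: c_def)
qed

text \<open>\<open>F\<close> is the cumulative Dirichlet energy.\<close>

lemma H01_on_energy_function:
  assumes H: "H01_on {a<..<b} u" and cont: "continuous_on {a..b} u" and "a < b"
  obtains F where "\<And>x y. a \<le> x \<Longrightarrow> x \<le> y \<Longrightarrow> y \<le> b \<Longrightarrow> (u y - u x)\<^sup>2 \<le> (y - x) * (F y - F x)"
    "mono_on {a..b} F"
proof -
  from H01_on_absolutely_continuous[OF assms] obtain u' where u': "L2_on {a<..<b} u'"
    and u: "\<And>x. x \<in> {a..b} \<Longrightarrow> u x = (LINT s:{a<..<x}|lebesgue. u' s)" by blast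
  have sub: "L2_on A u'" if "A \<subseteq> {a<..<b}" "A \<in> sets lebesgue" for A
    by (rule L2_on_subset[OF u' that(1) _ that(2)]) simp
  define F where "F x = (LINT s:{a<..<x}|lebesgue. (u' s)\<^sup>2)" for x
  have F: "F y - F x = (LINT s:{x<..<y}|lebesgue. (u' s)\<^sup>2)" if "a \<le> x" "x \<le> y" "y \<le> b" for x y
    using set_integral_split[OF that L2_on_square_integrable[OF u']] by (simp add: F_def)
  show ?thesis
  proof (rule that[of F])
    fix x y assume xy: "a \<le> x" "x \<le> y" "y \<le> b"
    have "u y - u x = (LINT s:{x<..<y}|lebesgue. u' s * 1)"
      using xy set_integral_split[OF xy L2_on_imp_integrable[OF _ u']] by (simp add: u)
    moreover have "L2_on {x<..<y} u'" using xy by (intro sub) auto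
    ultimately have "(u y - u x)\<^sup>2 \<le> (F y - F x) * (LINT s:{x<..<y}|lebesgue. 1\<^sup>2)"
      using L2_Cauchy_Schwarz[OF _ L2_on_const[of "{x<..<y}" 1]] by (simp add: F[OF xy])
    thus "(u y - u x)\<^sup>2 \<le> (y - x) * (F y - F x)"
      using xy by (simp add: set_lebesgue_integral_def mult.commute)
  next
    show "mono_on {a..b} F"
    proof (rule mono_onI)
      fix x y assume "x \<in> {a..b}" "y \<in> {a..b}" "x \<le> y"
      moreover have "0 \<le> (LINT s:{x<..<y}|lebesgue. (u' s)\<^sup>2)" by (rule set_integral_nonneg) simp
      ultimately show "F x \<le> F y" using F[of x y] by simp
    qed
  qed
qed

section \<open>Stability of Lagrange interpolation\<close>

lemma pderiv_sum: "pderiv (\<Sum>i\<in>A. f i) = (\<Sum>i\<in>A. pderiv (f i))"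
  by (induction A rule: infinite_finite_induct) (simp_all add: pderiv_add)

text \<open>Expanding \<open>q\<close> in the Lagrange basis \<open>l r\<close> of the nodes,
  \<open>C\<close> is the sum of bounds for the derivatives of the basis on the unit interval; it
  depends on the nodes alone.\<close>

lemma Lagrange_derivative_bound:
  fixes \<xi> :: "nat \<Rightarrow> real"
  assumes "inj_on \<xi> {..k}"
  obtains C where "0 \<le> C" "\<And>q M s. degree q \<le> k \<Longrightarrow> (\<And>r. r \<le> k \<Longrightarrow> \<bar>poly q (\<xi> r)\<bar> \<le> M) \<Longrightarrow>
    s \<in> {0..1} \<Longrightarrow> \<bar>poly (pderiv q) s\<bar> \<le> C * M"
proof -
  define l where "l r = (\<Prod>t\<in>{..k} - {r}. smult (1 / (\<xi> r - \<xi> t)) [:- \<xi> t, 1:])" for r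
  have ne: "\<xi> r \<noteq> \<xi> t" if "r \<le> k" "t \<le> k" "r \<noteq> t" for r t
    using assms that by (auto dest: inj_onD)
  have l: "poly (l r) (\<xi> s) = (if r = s then 1 else 0)" if "r \<le> k" "s \<le> k" for r s
  proof (cases "r = s")
    case True
    have "poly (l r) (\<xi> r) = (\<Prod>t\<in>{..k} - {r}. 1)"
      unfolding l_def poly_prod
    proof (rule prod.cong)
      fix t assume "t \<in> {..k} - {r}"
      hence "\<xi> r - \<xi> t \<noteq> 0" using ne[of r t] that by auto
      thus "poly (smult (1 / (\<xi> r - \<xi> t)) [:- \<xi> t, 1:]) (\<xi> r) = 1"
        by (simp add: diff_divide_distrib[symmetric])
    qed simp
    with True show ?thesis by simp
  next
    case False
    with that show ?thesis by (auto simp: l_def poly_prod)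
  qed
  have deg: "degree (l r) \<le> k" if "r \<le> k" for r
  proof -
    have "degree (l r) \<le> (\<Sum>t\<in>{..k} - {r}. degree (smult (1 / (\<xi> r - \<xi> t)) [:- \<xi> t, 1:]))"
      unfolding l_def by (rule order_trans[OF degree_prod_sum_le]) (auto simp: o_def)
    also have "\<dots> \<le> (\<Sum>t\<in>{..k} - {r}. 1)" by (intro sum_mono) auto
    finally show ?thesis using that by simp
  qed
  have "\<exists>B. \<forall>s\<in>{0..1}. \<bar>poly (pderiv (l r)) s\<bar> \<le> B" for r
  proof -
    have "bounded (poly (pderiv (l r)) ` {0..1::real})"
      by (intro compact_imp_bounded compact_continuous_image continuous_intros compact_Icc)
    thus ?thesis by (auto simp: bounded_iff)
  qed
  then obtain B where B: "\<And>r s. s \<in> {0..1} \<Longrightarrow> \<bar>poly (pderiv (l r)) s\<bar> \<le> B r" by metis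
  have B0: "0 \<le> B r" for r using B[of 0 r] by simp
  show ?thesis
  proof (rule that[of "\<Sum>r\<le>k. B r"])
    show "0 \<le> (\<Sum>r\<le>k. B r)" by (intro sum_nonneg B0)
  next
    fix q M and s :: real
    assume q: "degree q \<le> k" "\<And>r. r \<le> k \<Longrightarrow> \<bar>poly q (\<xi> r)\<bar> \<le> M" and s: "s \<in> {0..1}"
    have "q = (\<Sum>r\<le>k. smult (poly q (\<xi> r)) (l r))"
    proof (rule poly_eqI_degree[of "\<xi> ` {..k}"])
      fix x assume "x \<in> \<xi> ` {..k}"
      then obtain i where i: "i \<le> k" "x = \<xi> i" by auto
      have "poly (\<Sum>r\<le>k. smult (poly q (\<xi> r)) (l r)) x = (\<Sum>r\<le>k. if r = i then poly q x else 0)"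
        unfolding poly_sum by (rule sum.cong) (use i l in auto)
      thus "poly q x = poly (\<Sum>r\<le>k. smult (poly q (\<xi> r)) (l r)) x" using i by simp
    next
      show "degree q < card (\<xi> ` {..k})" using q card_image[OF assms] by simp
      have "degree (\<Sum>r\<le>k. smult (poly q (\<xi> r)) (l r)) \<le> k"
        by (intro degree_sum_le) (auto intro: deg order_trans[OF degree_smult_le])
      thus "degree (\<Sum>r\<le>k. smult (poly q (\<xi> r)) (l r)) < card (\<xi> ` {..k})"
        using card_image[OF assms] by simp
    qed
    hence "pderiv q = (\<Sum>r\<le>k. smult (poly q (\<xi> r)) (pderiv (l r)))"
      by (metis (no_types, lifting) pderiv_smult pderiv_sum sum.cong)
    hence "\<bar>poly (pderiv q) s\<bar> = \<bar>\<Sum>r\<le>k. poly q (\<xi> r) * poly (pderiv (l r)) s\<bar>"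
      by (simp add: poly_sum)
    also have "\<dots> \<le> (\<Sum>r\<le>k. M * B r)"
      by (rule order_trans[OF sum_abs], rule sum_mono)
         (use q s B in \<open>auto simp: abs_mult intro!: mult_mono order_trans[OF abs_ge_zero]\<close>)
    finally show "\<bar>poly (pderiv q) s\<bar> \<le> (\<Sum>r\<le>k. B r) * M"
      by (simp add: sum_distrib_left[symmetric] mult.commute)
  qed
qed

text \<open>Scaled to the unit interval, \<open>w\<close> minus its left-end value is on each
  element a polynomial whose nodal values are increments of \<open>v\<close>, hence at most
  \<open>sqrt (d * \<Delta>)\<close>, with \<open>d\<close> the element length and
  \<open>\<Delta>\<close> the growth of \<open>F\<close>. The resulting bounds on the element
  energies telescope.\<close>

lemma interpolant_energy_bound:
  assumes nodes: "reference_nodes k \<xi>"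
  obtains C where "0 \<le> C"
    "\<And>m z h v w F. mesh m z h \<Longrightarrow> lagrange_interpolant k \<xi> m z v w \<Longrightarrow> mono_on {0..1} F \<Longrightarrow>
      (\<And>x y. 0 \<le> x \<Longrightarrow> x \<le> y \<Longrightarrow> y \<le> 1 \<Longrightarrow> (v y - v x)\<^sup>2 \<le> (y - x) * (F y - F x)) \<Longrightarrow>
      L2_inner (deriv w) (deriv w) \<le> C * (F 1 - F 0)"
proof -
  have \<xi>: "\<xi> r \<in> {0..1}" if "r \<le> k" for r
    using nodes that strict_mono_on_leD[of "{..k}" \<xi> 0 r] strict_mono_on_leD[of "{..k}" \<xi> r k]
    by (auto simp: reference_nodes_def)
  have "inj_on \<xi> {..k}" using nodes by (auto simp: reference_nodes_def strict_mono_on_imp_inj_on)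
  from Lagrange_derivative_bound[OF this] obtain C where C: "0 \<le> C"
    "\<And>q M s. degree q \<le> k \<Longrightarrow> (\<And>r. r \<le> k \<Longrightarrow> \<bar>poly q (\<xi> r)\<bar> \<le> M) \<Longrightarrow>
      s \<in> {0..1} \<Longrightarrow> \<bar>poly (pderiv q) s\<bar> \<le> C * M" by blast
  show ?thesis
  proof (rule that[of "C\<^sup>2"])
    fix m z h v w F
    assume mesh: "mesh m z h" and w: "lagrange_interpolant k \<xi> m z v w" and F: "mono_on {0..1} F"
      and v: "\<And>x y. 0 \<le> x \<Longrightarrow> x \<le> y \<Longrightarrow> y \<le> 1 \<Longrightarrow> (v y - v x)\<^sup>2 \<le> (y - x) * (F y - F x)"
    have w_fe: "w \<in> fe_space k m z" using w by (simp add: lagrange_interpolant_def)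
    have dw2: "set_integrable lebesgue {0<..<1} (\<lambda>x. (deriv w x)\<^sup>2)"
      by (intro L2_on_square_integrable fe_space_deriv_L2[OF mesh w_fe])
    have element: "(LINT x:{z j<..<z (Suc j)}|lebesgue. (deriv w x)\<^sup>2) \<le> C\<^sup>2 * (F (z (Suc j)) - F (z j))"
      if j: "j < m" for j
    proof -
      define d where "d = z (Suc j) - z j"
      define \<Delta> where "\<Delta> = F (z (Suc j)) - F (z j)"
      have d: "0 < d" using mesh j by (simp add: mesh_def d_def)
      have zj: "0 \<le> z j" "z (Suc j) \<le> 1" using mesh_range[OF mesh, of j] mesh_range[OF mesh, of "Suc j"] j by auto
      have \<Delta>: "0 \<le> \<Delta>" using mono_onD[OF F, of "z j" "z (Suc j)"] zj d by (simp add: \<Delta>_def d_def)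
      obtain p where p: "degree p \<le> k" "\<And>x. x \<in> {z j..z (Suc j)} \<Longrightarrow> w x = poly p x"
        "\<And>x. z j < x \<Longrightarrow> x < z (Suc j) \<Longrightarrow> (w has_real_derivative poly (pderiv p) x) (at x)"
        using fe_space_has_derivative[OF w_fe j] by blast
      \<comment> \<open>Subtracting a constant leaves the derivative unchanged but makes the nodal
        values small; without it they would not scale with \<open>d\<close>.\<close>
      define q where "q = pcompose p [:z j, d:] - [:poly p (z j):]"
      have "degree q \<le> k"
        unfolding q_def using p(1) d by (intro degree_diff_le) (auto simp: degree_pcompose)
      moreover have "\<bar>poly q (\<xi> r)\<bar> \<le> sqrt (d * \<Delta>)" if r: "r \<le> k" for r
      proof -
        let ?y = "z j + d * \<xi> r"
        have "d * \<xi> r \<le> d" using \<xi>[OF r] d by (simp add: mult_left_le)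
        moreover have "z j + d = z (Suc j)" by (simp add: d_def)
        ultimately have y: "z j \<le> ?y" "?y \<le> z (Suc j)" using \<xi>[OF r] d by (simp, linarith)
        \<comment> \<open>The left end is a node since \<open>\<xi> 0 = 0\<close>, so the subtracted
          constant is a value of \<open>v\<close> too.\<close>
        have "w ?y = v ?y" "w (z j + d * \<xi> 0) = v (z j + d * \<xi> 0)"
          using w j r unfolding lagrange_interpolant_def d_def by blast+
        hence "w ?y = v ?y" "w (z j) = v (z j)" using nodes by (simp_all add: reference_nodes_def)
        hence "poly q (\<xi> r) = v ?y - v (z j)"
          using p(2)[of ?y] p(2)[of "z j"] y d by (simp add: q_def poly_pcompose d_def algebra_simps)
        hence "(poly q (\<xi> r))\<^sup>2 \<le> (?y - z j) * (F ?y - F (z j))"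
          using v[of "z j" ?y] y zj by simp
        also have "\<dots> \<le> d * \<Delta>"
        proof (rule mult_mono)
          show "?y - z j \<le> d" using \<open>d * \<xi> r \<le> d\<close> by simp
          have F_mono: "F (z j) \<le> F ?y" "F ?y \<le> F (z (Suc j))"
            by (rule mono_onD[OF F]; use y zj d in simp)+
          thus "F ?y - F (z j) \<le> \<Delta>" "0 \<le> F ?y - F (z j)" by (simp_all add: \<Delta>_def)
        qed (use d in simp)
        finally show ?thesis by (simp add: real_le_rsqrt)
      qed
      ultimately have q: "\<bar>poly (pderiv q) s\<bar> \<le> C * sqrt (d * \<Delta>)" if "s \<in> {0..1}" for s
        using C(2) that by blast
      \<comment> \<open>Undoing the scaling divides the derivative by \<open>d\<close>; the square
        is at most \<open>C^2 * \<Delta> / d\<close>, and integration over length \<open>d\<close>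
        removes \<open>d\<close> altogether. Hence the constant does not depend on the mesh.\<close>
      have bound: "(deriv w x)\<^sup>2 \<le> C\<^sup>2 * \<Delta> / d * 1" if x: "x \<in> {z j<..<z (Suc j)}" for x
      proof -
        let ?s = "(x - z j) / d"
        have "?s \<in> {0..1}" using x d by (auto simp: d_def field_simps)
        moreover have "poly (pderiv q) ?s = d * deriv w x"
          using DERIV_imp_deriv[OF p(3), of x] x d
          by (simp add: q_def pderiv_diff pderiv_pcompose poly_pcompose pderiv_pCons)
        ultimately have "\<bar>d * deriv w x\<bar>\<^sup>2 \<le> (C * sqrt (d * \<Delta>))\<^sup>2"
          using q[of ?s] by (intro power_mono) auto
        hence "d * (d * (deriv w x)\<^sup>2) \<le> d * (C\<^sup>2 * \<Delta>)"
          using d \<Delta> by (simp add: power_mult_distrib power2_eq_square algebra_simps)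
        with d show ?thesis by (simp add: field_simps)
      qed
      have "(LINT x:{z j<..<z (Suc j)}|lebesgue. (deriv w x)\<^sup>2)
          \<le> (LINT x:{z j<..<z (Suc j)}|lebesgue. C\<^sup>2 * \<Delta> / d * 1)"
        using zj by (intro set_integral_mono bound set_integrable_subset[OF dw2]
            set_integrable_mult_right L2_on_imp_integrable L2_on_const) auto
      also have "\<dots> = C\<^sup>2 * \<Delta>"
        using d by (simp add: set_lebesgue_integral_def d_def)
      finally show ?thesis by (simp add: \<Delta>_def)
    qed
    have "i \<le> m \<Longrightarrow> (LINT x:{0<..<z i}|lebesgue. (deriv w x)\<^sup>2) \<le> C\<^sup>2 * (F (z i) - F 0)" for i
    proof (induction i)
      case 0
      thus ?case using mesh by (simp add: mesh_def set_lebesgue_integral_def)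
    next
      case (Suc i)
      have "(LINT x:{0<..<z (Suc i)}|lebesgue. (deriv w x)\<^sup>2)
          = (LINT x:{0<..<z i}|lebesgue. (deriv w x)\<^sup>2) + (LINT x:{z i<..<z (Suc i)}|lebesgue. (deriv w x)\<^sup>2)"
        using Suc.prems mesh_range[OF mesh, of i] mesh_range[OF mesh, of "Suc i"]
          mesh_mono[OF mesh, of i "Suc i"]
        by (intro set_integral_split[OF _ _ _ dw2]) auto
      also have "\<dots> \<le> C\<^sup>2 * (F (z i) - F 0) + C\<^sup>2 * (F (z (Suc i)) - F (z i))"
        using Suc element by (intro add_mono) auto
      finally show ?case by (simp add: algebra_simps)
    qed
    from this[of m] mesh show "L2_inner (deriv w) (deriv w) \<le> C\<^sup>2 * (F 1 - F 0)"
      by (simp add: L2_inner_def mesh_def power2_eq_square[symmetric])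
  qed simp
qed

section \<open>Uniqueness\<close>

text \<open>\<open>\<delta>\<^sub>0\<close> is fixed before the mesh, the number of steps and the
  iterates, so every constant below is built from the data of the problem, the reference nodes and
  the bound \<open>G\<close> on the sampled right-hand side.\<close>

theorem theorem13:
  fixes T \<gamma>\<^sub>0 \<gamma>\<^sub>1 \<gamma>max \<alpha>max m\<^sub>a M\<^sub>a :: real
    and \<alpha> \<beta> \<gamma> :: "real \<Rightarrow> real"
    and u0 :: "'n::finite \<Rightarrow> real \<Rightarrow> real"
    and f :: "'n \<Rightarrow> real \<Rightarrow> real \<Rightarrow> real"
    and a :: "'n \<Rightarrow> real ^ 'n \<Rightarrow> real"
    and k :: nat and \<xi> :: "nat \<Rightarrow> real"
  assumes "0 < T"
    and "C2_on {0..T} \<alpha>" and "C2_on {0..T} \<beta>"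
    and "L2_on {0<..<T} (ddt T \<alpha>)" and "L2_on {0<..<T} (ddt T \<beta>)"
    and "\<gamma> = (\<lambda>t. \<beta> t - \<alpha> t)"
    and "0 < \<gamma>\<^sub>0" and "\<forall>t\<in>{0..T}. \<gamma>\<^sub>0 < \<gamma> t \<and> \<gamma> t < \<gamma>\<^sub>1"
    and "\<forall>t\<in>{0..T}. \<bar>ddt T \<gamma> t\<bar> \<le> \<gamma>max" and "\<forall>t\<in>{0..T}. \<bar>ddt T \<alpha> t\<bar> \<le> \<alpha>max"
    and "\<forall>i. H01_on {\<alpha> 0<..<\<beta> 0} (u0 i) \<and> continuous_on {\<alpha> 0..\<beta> 0} (u0 i)"
    and "\<forall>i. L2_on (space_time_domain T \<alpha> \<beta>) (\<lambda>(x, t). f i x t)"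
    and "\<forall>i. \<exists>L. L-lipschitz_on UNIV (a i)"
    and "0 < m\<^sub>a" and "\<forall>i s. m\<^sub>a \<le> a i s \<and> a i s \<le> M\<^sub>a"
    and "1 \<le> k" and "reference_nodes k \<xi>"
  shows "\<forall>c\<^sub>1 c\<^sub>2 G. 0 < c\<^sub>1 \<longrightarrow> 0 < c\<^sub>2 \<longrightarrow>
    (\<exists>\<delta>\<^sub>0>0. \<forall>N \<delta> m z h.
       0 < \<delta> \<and> \<delta> < \<delta>\<^sub>0 \<and> real N * \<delta> = T \<and> mesh m z h \<and> c\<^sub>1 * h\<^sup>2 \<le> \<delta> \<and> \<delta> \<le> c\<^sub>2 * h\<^sup>2 \<and>
       sampled_data_bound (\<lambda>i. rhs_g \<alpha> \<gamma> (f i)) \<delta> N G \<longrightarrow>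
       (let step = cn_step T \<alpha> \<gamma> a (\<lambda>i. rhs_g \<alpha> \<gamma> (f i)) (fe_space k m z) \<delta> in
        \<forall>n\<in>{1..N}. \<forall>V :: nat \<Rightarrow> 'n \<Rightarrow> real \<Rightarrow> real.
          (\<forall>i. lagrange_interpolant k \<xi> m z (init_v \<alpha> \<gamma> (u0 i)) (V 0 i)) \<and>
          (\<forall>q\<in>{1..<n}. step q (V (q - 1)) (V q)) \<longrightarrow>
          (\<forall>X Y. step n (V (n - 1)) X \<and> step n (V (n - 1)) Y \<longrightarrow>
             (\<forall>i. \<forall>y\<in>{0..1}. X i y = Y i y))))"
proof (unfold Let_def, intro allI impI)
  fix c\<^sub>1 c\<^sub>2 G :: real
  assume "0 < c\<^sub>1" "0 < c\<^sub>2"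
  note \<gamma> = assms(6) and \<gamma>_bound = assms(8) and ddt_bound = assms(9,10) and H = assms(11)
    and lip = assms(13) and m_pos = assms(14) and a_bound = assms(15) and nodes = assms(17)
  have T: "0 < T" and \<gamma>\<^sub>0: "0 < \<gamma>\<^sub>0" by (fact assms)+
  have "0 \<in> {0..T}" using T by simp
  with \<gamma>_bound have \<gamma>_start: "\<gamma>\<^sub>0 < \<gamma> 0" "\<gamma> 0 < \<gamma>\<^sub>1" by blast+
  hence \<gamma>\<^sub>1: "0 < \<gamma>\<^sub>1" using \<gamma>\<^sub>0 by linarith
  \<comment> \<open>\<open>B\<close> bounds the convection coefficient, as \<open>y\<close> stays
    below 1; \<open>\<mu>\<close> bounds \<open>a i s * coeff_b2\<close> from below, as
    \<open>\<gamma>\<close> stays below \<open>\<gamma>\<^sub>1\<close>.\<close>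
  define B where "B = (\<alpha>max + \<gamma>max) / \<gamma>\<^sub>0"
  define \<mu> where "\<mu> = m\<^sub>a / \<gamma>\<^sub>1\<^sup>2"
  have \<mu>: "0 < \<mu>" using m_pos \<gamma>\<^sub>1 by (simp add: \<mu>_def)
  have "\<exists>D. \<forall>m z h w. mesh m z h \<longrightarrow> lagrange_interpolant k \<xi> m z (init_v \<alpha> \<gamma> (u0 i)) w \<longrightarrow>
      L2_inner (deriv w) (deriv w) \<le> D" for i
  proof -
    let ?\<gamma> = "\<gamma> 0"
    have \<gamma>0: "0 < ?\<gamma>" using \<gamma>_start \<gamma>\<^sub>0 by linarith
    hence "\<alpha> 0 < \<beta> 0" by (simp add: \<gamma>)
    from H01_on_energy_function[OF _ _ this] H obtain F where F: "mono_on {\<alpha> 0..\<beta> 0} F"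
      "\<And>x y. \<alpha> 0 \<le> x \<Longrightarrow> x \<le> y \<Longrightarrow> y \<le> \<beta> 0 \<Longrightarrow> (u0 i y - u0 i x)\<^sup>2 \<le> (y - x) * (F y - F x)"
      by metis
    \<comment> \<open>The affine map stretches \<open>y - x\<close> by \<open>?\<gamma>\<close>;
      moving this factor into the energy keeps the inequality in the same form.\<close>
    define F' where "F' y = ?\<gamma> * F (\<alpha> 0 + ?\<gamma> * y)" for y
    have le: "?\<gamma> * y \<le> \<beta> 0 - \<alpha> 0" if "y \<le> 1" for y
      using mult_left_mono[OF that, of ?\<gamma>] \<gamma>0 by (simp add: \<gamma>)
    have F': "mono_on {0..1} F'"
    proof (rule mono_onI)
      fix x y :: real assume xy: "x \<in> {0..1}" "y \<in> {0..1}" "x \<le> y"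
      have "F (\<alpha> 0 + ?\<gamma> * x) \<le> F (\<alpha> 0 + ?\<gamma> * y)"
        using xy \<gamma>0 le[of x] le[of y] by (intro mono_onD[OF F(1)]) auto
      thus "F' x \<le> F' y" unfolding F'_def using \<gamma>0 by (intro mult_left_mono) auto
    qed
    have v: "(init_v \<alpha> \<gamma> (u0 i) y - init_v \<alpha> \<gamma> (u0 i) x)\<^sup>2 \<le> (y - x) * (F' y - F' x)"
      if "0 \<le> x" "x \<le> y" "y \<le> 1" for x y
      using F(2)[of "\<alpha> 0 + ?\<gamma> * x" "\<alpha> 0 + ?\<gamma> * y"] that \<gamma>0 le[of y]
      by (simp add: init_v_def F'_def algebra_simps)
    from interpolant_energy_bound[OF nodes] F' v show ?thesis by metis
  qed
  then obtain D\<^sub>0 where D\<^sub>0: "\<And>i m z h w. mesh m z h \<Longrightarrow>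
      lagrange_interpolant k \<xi> m z (init_v \<alpha> \<gamma> (u0 i)) w \<Longrightarrow> L2_inner (deriv w) (deriv w) \<le> D\<^sub>0 i"
    by metis
  obtain L\<^sub>i where L\<^sub>i: "\<And>i. (L\<^sub>i i)-lipschitz_on UNIV (a i)" using lip by metis
  define L where "L = (\<Sum>i\<in>UNIV. L\<^sub>i i)"
  have L0: "0 \<le> L\<^sub>i i" for i using L\<^sub>i by (rule lipschitz_on_nonneg)
  have L: "L\<^sub>i i \<le> L" for i unfolding L_def by (intro member_le_sum L0) auto
  hence L_nonneg: "0 \<le> L" using L0[of undefined] order_trans by blast
  text \<open>\<open>E\<close> bounds the squared \<open>L\<^sub>2\<close> norm of \<open>\<partial>V\<^sub>i\<^sup>(\<^sup>n\<^sup>)/\<partial>y\<close>, uniformly in the discretisation.\<close>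
  define E where "E = exp (3 * B\<^sup>2 * T / (2 * \<mu>)) * ((\<Sum>i\<in>UNIV. \<bar>D\<^sub>0 i\<bar>) + \<bar>G\<bar> / \<mu>)"
  \<comment> \<open>Lipschitz constant of the diffusion coefficient: \<open>CARD('n)\<close> from
    bounding the Euclidean norm by the sum of the components, \<open>\<gamma>\<^sub>1\<close> from
    the nonlocal term, \<open>1 / \<gamma>\<^sub>0^2\<close> from \<open>coeff_b2\<close>.\<close>
  define C where "C = real CARD('n) * L * \<gamma>\<^sub>1 / \<gamma>\<^sub>0\<^sup>2"
  \<comment> \<open>The first entry ensures \<open>s <= 1/2\<close> in the Gronwall argument, the
    second makes the factor in the final estimate strictly positive. The added 1 keeps the
    denominators positive.\<close>
  define \<delta>\<^sub>0 where "\<delta>\<^sub>0 = min (\<mu> / (B\<^sup>2 + 1)) (4 * \<mu> / (C\<^sup>2 * E + B\<^sup>2 + 1))"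
  have E: "0 \<le> E" unfolding E_def using \<mu> by (intro mult_nonneg_nonneg add_nonneg_nonneg sum_nonneg) auto
  have den: "0 < C\<^sup>2 * E + B\<^sup>2 + 1" using E by (intro add_nonneg_pos add_nonneg_nonneg) auto
  have den': "0 < B\<^sup>2 + 1" by (intro add_nonneg_pos) auto
  let ?step = "\<lambda>\<delta> m z. cn_step T \<alpha> \<gamma> a (\<lambda>i. rhs_g \<alpha> \<gamma> (f i)) (fe_space k m z) \<delta>"
  have \<delta>\<^sub>0: "0 < \<delta>\<^sub>0" using \<mu> den den' by (simp add: \<delta>\<^sub>0_def)
  have unique: "X i y = Y i y"
    if n: "n \<in> {1..N}" and y: "y \<in> {0..1}"
      and \<delta>: "0 < \<delta>" "\<delta> < \<delta>\<^sub>0" and N: "real N * \<delta> = T" and mesh: "mesh m z h"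
      and data: "sampled_data_bound (\<lambda>i. rhs_g \<alpha> \<gamma> (f i)) \<delta> N G"
      and V0: "\<forall>i. lagrange_interpolant k \<xi> m z (init_v \<alpha> \<gamma> (u0 i)) (V 0 i)"
      and steps: "\<forall>q\<in>{1..<n}. ?step \<delta> m z q (V (q - 1)) (V q)"
      and X: "?step \<delta> m z n (V (n - 1)) X" and Y: "?step \<delta> m z n (V (n - 1)) Y"
    for N m n :: nat and \<delta> h y :: real and z :: "nat \<Rightarrow> real"
      and V :: "nat \<Rightarrow> 'n \<Rightarrow> real \<Rightarrow> real" and X Y :: "'n \<Rightarrow> real \<Rightarrow> real" and i :: 'n
  proof -
    let ?S = "fe_space k m z" and ?g = "\<lambda>i. rhs_g \<alpha> \<gamma> (f i)"
    have time: "t_mid \<delta> q \<in> {0..T}" if "q \<in> {1..N}" for q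
    proof -
      have "1 \<le> real q" "real q \<le> real N" using that by auto
      hence "0 \<le> (real q - 1) * \<delta>" "real q * \<delta> \<le> T"
        using \<delta>(1) N mult_right_mono[of "real q" "real N" \<delta>] by auto
      thus ?thesis using \<delta>(1) by (simp add: t_mid_def algebra_simps)
    qed
    have b_bound: "\<bar>coeff_b1 T \<alpha> \<gamma> y (t_mid \<delta> q)\<bar> \<le> B" if q: "q \<in> {1..N}" and "y \<in> {0<..<1}" for q y
    proof -
      let ?t = "t_mid \<delta> q"
      have t: "?t \<in> {0..T}" by (rule time[OF q])
      have "\<bar>ddt T \<alpha> ?t + ddt T \<gamma> ?t * y\<bar> \<le> \<bar>ddt T \<alpha> ?t\<bar> + \<bar>ddt T \<gamma> ?t\<bar> * \<bar>y\<bar>"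
        by (simp add: abs_mult[symmetric] abs_triangle_ineq)
      also have "\<dots> \<le> \<alpha>max + \<gamma>max * 1"
        using ddt_bound t that(2) by (intro add_mono mult_mono) (auto intro: order_trans[OF abs_ge_zero])
      finally have "\<bar>ddt T \<alpha> ?t + ddt T \<gamma> ?t * y\<bar> \<le> \<alpha>max + \<gamma>max" by simp
      moreover have "\<gamma>\<^sub>0 \<le> \<gamma> ?t" "0 < \<gamma> ?t" using \<gamma>_bound t \<gamma>\<^sub>0 by force+
      ultimately show ?thesis
        unfolding coeff_b1_def B_def using \<gamma>\<^sub>0 by (auto simp: abs_divide intro!: frac_le)
    qed
    have b_cont: "continuous_on {0..1} (\<lambda>y. coeff_b1 T \<alpha> \<gamma> y (t_mid \<delta> q))" for q
      unfolding coeff_b1_def divide_inverse by (intro continuous_intros)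
    have b2: "\<mu> \<le> a i s * coeff_b2 \<gamma> (t_mid \<delta> q)" "0 \<le> coeff_b2 \<gamma> (t_mid \<delta> q)"
      "coeff_b2 \<gamma> (t_mid \<delta> q) \<le> 1 / \<gamma>\<^sub>0\<^sup>2" if q: "q \<in> {1..N}" for q i s
    proof -
      let ?t = "t_mid \<delta> q"
      have \<gamma>t: "\<gamma>\<^sub>0 \<le> \<gamma> ?t" "\<gamma> ?t \<le> \<gamma>\<^sub>1" "0 < \<gamma> ?t" using \<gamma>_bound time[OF q] \<gamma>\<^sub>0 by force+
      show "0 \<le> coeff_b2 \<gamma> ?t" by (simp add: coeff_b2_def)
      show "coeff_b2 \<gamma> ?t \<le> 1 / \<gamma>\<^sub>0\<^sup>2"
        unfolding coeff_b2_def using \<gamma>t \<gamma>\<^sub>0 by (intro frac_le power_mono) auto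
      have "m\<^sub>a * (1 / \<gamma>\<^sub>1\<^sup>2) \<le> a i s * (1 / (\<gamma> ?t)\<^sup>2)"
        using \<gamma>t a_bound m_pos by (intro mult_mono frac_le power_mono) (auto intro: less_imp_le order_trans)
      thus "\<mu> \<le> a i s * coeff_b2 \<gamma> ?t" by (simp add: \<mu>_def coeff_b2_def)
    qed
    have fe: "U i \<in> ?S" if "?step \<delta> m z q U' U" for q U U' i
      using that by (simp add: cn_step_def Let_def)
    have scheme: "L2_inner (\<lambda>y. (U i y - U' i y) / \<delta>) W
        + a i (\<chi> j. nonlocal_l \<gamma> (t_mid \<delta> q) (\<lambda>y. (U j y + U' j y) / 2)) * coeff_b2 \<gamma> (t_mid \<delta> q)
          * L2_inner (deriv (\<lambda>y. (U i y + U' i y) / 2)) (deriv W)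
        - L2_inner (\<lambda>y. coeff_b1 T \<alpha> \<gamma> y (t_mid \<delta> q) * deriv (\<lambda>y. (U i y + U' i y) / 2) y) W
        = L2_inner (\<lambda>y. ?g i y (t_mid \<delta> q)) W" if "?step \<delta> m z q U' U" "W \<in> ?S" for q U U' i W
      using that by (simp add: cn_step_def Let_def)
    \<comment> \<open>With \<open>Y\<close> as entry \<open>n\<close>, the energy bound
      \<open>H1\<close> covers the previous iterates and \<open>Y\<close> at once; entry
      \<open>n\<close> of \<open>V\<close> itself is arbitrary.\<close>
    define V' where "V' = V(n := Y)"
    have step': "?step \<delta> m z q (V' (q - 1)) (V' q)" if "q \<in> {1..n}" for q
      using that steps Y n by (cases "q = n") (auto simp: V'_def)
    have fe': "V' q i \<in> ?S" if "q \<le> n" for q i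
      using that V0 fe[OF step', of q i] n by (cases "q = 0") (auto simp: V'_def lagrange_interpolant_def)
    have H1: "L2_inner (deriv (V' p i)) (deriv (V' p i)) \<le> E" if p: "p \<le> n" for p i
    proof -
      define s where "s = \<delta> * B\<^sup>2 / (2 * \<mu>)"
      define x where "x q = L2_inner (deriv (V' q i)) (deriv (V' q i))" for q
      define \<eta> where "\<eta> q = \<delta> / \<mu> * L2_inner (\<lambda>y. ?g i y (t_mid \<delta> q)) (\<lambda>y. ?g i y (t_mid \<delta> q))" for q
      have s0: "0 \<le> s" using \<delta> \<mu> by (simp add: s_def)
      have \<eta>0: "0 \<le> \<eta> q" for q
        unfolding \<eta>_def using \<delta> \<mu> by (intro mult_nonneg_nonneg L2_inner_self_nonneg) auto
      have x0: "0 \<le> x q" for q unfolding x_def by (rule L2_inner_self_nonneg)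
      have "x p \<le> exp (3 * s * real p) * (x 0 + (\<Sum>q=1..p. \<eta> q))"
      proof (rule discrete_Gronwall[OF s0 _ x0 \<eta>0])
        have "\<delta> * B\<^sup>2 \<le> \<delta> * (B\<^sup>2 + 1)" using \<delta> by (intro mult_left_mono) auto
        also have "\<dots> \<le> \<mu>" using \<delta> den' by (simp add: \<delta>\<^sub>0_def pos_less_divide_eq)
        finally show "s \<le> 1 / 2" using \<mu> by (simp add: s_def field_simps)
      next
        fix q assume "q < p"
        hence q: "Suc q \<in> {1..n}" "Suc q \<in> {1..N}" "q \<le> n" "Suc q \<le> n" using p n by auto
        have step: "?step \<delta> m z (Suc q) (V' q) (V' (Suc q))" using step'[OF q(1)] by simp
        have "\<mu> * (x (Suc q) - x q) \<le> \<delta> * (B\<^sup>2 / 2 * (x (Suc q) + x q)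
            + L2_inner (\<lambda>y. ?g i y (t_mid \<delta> (Suc q))) (\<lambda>y. ?g i y (t_mid \<delta> (Suc q))))"
          unfolding x_def
          by (rule energy_step[OF mesh fe'[OF q(4)] fe'[OF q(3)] b_cont b_bound[OF q(2)] _ \<mu> b2(1)[OF q(2)] \<delta>(1)
                scheme[OF step]])
             (use data q in \<open>auto simp: sampled_data_bound_def\<close>)
        thus "x (Suc q) - x q \<le> s * (x (Suc q) + x q) + \<eta> (Suc q)"
          using \<mu> by (simp add: s_def \<eta>_def field_simps)
      qed
      also have "\<dots> \<le> E"
        unfolding E_def
      proof (intro mult_mono add_mono)
        \<comment> \<open>The number of steps enters the exponent \<open>3 * s * p\<close> only
          through the elapsed time \<open>p * \<delta>\<close>; this removes the dependence on
          \<open>\<delta>\<close>.\<close>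
        have "real p * \<delta> \<le> T" using p n N \<delta>(1) mult_right_mono[of "real p" "real N" \<delta>] by auto
        hence "3 * B\<^sup>2 / (2 * \<mu>) * (real p * \<delta>) \<le> 3 * B\<^sup>2 / (2 * \<mu>) * T"
          using \<mu> by (intro mult_left_mono) auto
        thus "exp (3 * s * real p) \<le> exp (3 * B\<^sup>2 * T / (2 * \<mu>))" by (simp add: s_def mult_ac)
        have "V' 0 = V 0" using n by (simp add: V'_def)
        hence "x 0 \<le> D\<^sub>0 i" unfolding x_def using D\<^sub>0[OF mesh] V0 by simp
        also have "\<dots> \<le> \<bar>D\<^sub>0 i\<bar>" by simp
        also have "\<dots> \<le> (\<Sum>i\<in>UNIV. \<bar>D\<^sub>0 i\<bar>)" by (intro member_le_sum) auto
        finally show "x 0 \<le> (\<Sum>i\<in>UNIV. \<bar>D\<^sub>0 i\<bar>)" .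
        let ?N = "\<lambda>q j. L2_inner (\<lambda>y. ?g j y (t_mid \<delta> q)) (\<lambda>y. ?g j y (t_mid \<delta> q))"
        have "(\<Sum>q=1..p. \<eta> q) \<le> (\<Sum>q=1..N. \<eta> q)"
          using p n by (intro sum_mono2 \<eta>0) auto
        \<comment> \<open>The energy of one component sees only its own data; the norms of the
          others are added to reach the sum bounded by \<open>G\<close>.\<close>
        also have "\<dots> \<le> (\<Sum>q=1..N. \<delta> / \<mu> * (\<Sum>j\<in>UNIV. ?N q j))"
          unfolding \<eta>_def using \<delta> \<mu>
          by (intro sum_mono mult_left_mono member_le_sum L2_inner_self_nonneg) auto
        also have "\<dots> = (\<Sum>q=1..N. \<delta> * (\<Sum>j\<in>UNIV. ?N q j)) / \<mu>"
          by (simp add: sum_divide_distrib)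
        also have "\<dots> \<le> \<bar>G\<bar> / \<mu>"
          using data \<mu> by (intro divide_right_mono)
            (auto simp: sampled_data_bound_def L2_inner_def power2_eq_square)
        finally show "(\<Sum>q=1..p. \<eta> q) \<le> \<bar>G\<bar> / \<mu>" .
      qed (use x0 \<eta>0 in \<open>auto intro!: add_nonneg_nonneg sum_nonneg\<close>)
      finally show ?thesis by (simp add: x_def)
    qed
    have V'_n: "V' n = Y" "V' (n - 1) = V (n - 1)" using n by (auto simp: V'_def)
    have Vn: "V (n - 1) j \<in> ?S" for j using fe'[of "n - 1" j] unfolding V'_n by simp
    have hY: "sqrt (L2_inner (deriv (\<lambda>y. (Y i y + V (n - 1) i y) / 2)) (deriv (\<lambda>y. (Y i y + V (n - 1) i y) / 2))) \<le> sqrt E" for i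
    proof -
      have "L2_inner (deriv (\<lambda>y. (Y i y + V (n - 1) i y) / 2)) (deriv (\<lambda>y. (Y i y + V (n - 1) i y) / 2))
          \<le> (L2_inner (deriv (Y i)) (deriv (Y i)) + L2_inner (deriv (V (n - 1) i)) (deriv (V (n - 1) i))) / 2"
        by (rule deriv_average_norm[OF mesh fe[OF Y] Vn])
      also have "\<dots> \<le> E" using H1[of n i] H1[of "n - 1" i] unfolding V'_n by simp
      finally show ?thesis by simp
    qed
    let ?e = "\<lambda>i y. (X i y - Y i y) / 2"
    define \<rho> where "\<rho> i = L2_inner (?e i) (?e i)" for i
    \<comment> \<open>Each coefficient depends on all components, so an estimate for a fixed
      component would not close; for the largest difference all others are bounded by it.\<close>
    obtain i\<^sub>0 where i\<^sub>0: "\<And>i. \<rho> i \<le> \<rho> i\<^sub>0"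
    proof -
      have "Max (range \<rho>) \<in> range \<rho>" by (intro Max_in) auto
      then obtain i\<^sub>0 where "Max (range \<rho>) = \<rho> i\<^sub>0" by blast
      moreover have "\<rho> i \<le> Max (range \<rho>)" for i by (intro Max_ge) auto
      ultimately show ?thesis using that by metis
    qed
    have \<rho>_nonneg: "0 \<le> \<rho> i" for i by (simp add: \<rho>_def L2_inner_self_nonneg)
    let ?aX = "a i\<^sub>0 (\<chi> j. nonlocal_l \<gamma> (t_mid \<delta> n) (\<lambda>y. (X j y + V (n - 1) j y) / 2))"
      and ?aY = "a i\<^sub>0 (\<chi> j. nonlocal_l \<gamma> (t_mid \<delta> n) (\<lambda>y. (Y j y + V (n - 1) j y) / 2))"
    have diff: "\<bar>?aX * coeff_b2 \<gamma> (t_mid \<delta> n) - ?aY * coeff_b2 \<gamma> (t_mid \<delta> n)\<bar> \<le> C * sqrt (\<rho> i\<^sub>0)"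
    proof -
      let ?t = "t_mid \<delta> n"
      let ?lX = "\<chi> j. nonlocal_l \<gamma> ?t (\<lambda>y. (X j y + V (n - 1) j y) / 2)"
        and ?lY = "\<chi> j. nonlocal_l \<gamma> ?t (\<lambda>y. (Y j y + V (n - 1) j y) / 2)"
      have \<gamma>t: "0 < \<gamma> ?t" "\<gamma> ?t \<le> \<gamma>\<^sub>1" using \<gamma>_bound time[OF n] \<gamma>\<^sub>0 by force+
      have l: "\<bar>(?lX - ?lY) $ j\<bar> \<le> \<gamma>\<^sub>1 * sqrt (\<rho> i\<^sub>0)" for j
      proof -
        have L2: "L2_on {0<..<1} (\<lambda>y. (X j y + V (n - 1) j y) / 2)"
          "L2_on {0<..<1} (\<lambda>y. (Y j y + V (n - 1) j y) / 2)"
          using fe[OF X] fe[OF Y] Vn by (blast intro: fe_space_L2 fe_space_half_sum)+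
        have e: "?e j \<in> ?S"
          using fe_space_lincomb[OF fe[OF X] fe[OF Y], of "1/2" j "-1/2" j] by (simp add: diff_divide_distrib)
        have "(?lX - ?lY) $ j = \<gamma> ?t * (LINT y:{0<..<1}|lebesgue.
            (X j y + V (n - 1) j y) / 2 - (Y j y + V (n - 1) j y) / 2)"
          by (subst set_integral_diff(2)[OF L2_on_imp_integrable[OF _ L2(1)] L2_on_imp_integrable[OF _ L2(2)]])
             (simp_all add: nonlocal_l_def right_diff_distrib)
        \<comment> \<open>The previous iterate cancels, so the nonlocal terms differ by the mean of
          \<open>?e j\<close>, which its L2 norm controls.\<close>
        also have "\<dots> = \<gamma> ?t * L2_inner (?e j) (\<lambda>_. 1)"
          by (simp add: L2_inner_def diff_divide_distrib[symmetric])
        finally have "\<bar>(?lX - ?lY) $ j\<bar> = \<gamma> ?t * \<bar>L2_inner (?e j) (\<lambda>_. 1)\<bar>" using \<gamma>t by (simp add: abs_mult)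
        also have "\<dots> \<le> \<gamma>\<^sub>1 * sqrt (\<rho> j)"
        proof (intro mult_mono)
          have "L2_inner (\<lambda>_. 1) (\<lambda>_. 1) = 1" by (simp add: L2_inner_def set_lebesgue_integral_def)
          thus "\<bar>L2_inner (?e j) (\<lambda>_. 1)\<bar> \<le> sqrt (\<rho> j)"
            using L2_inner_Cauchy_Schwarz[OF fe_space_L2[OF e] L2_on_const[of _ 1]] by (simp add: \<rho>_def)
        qed (use \<gamma>t in auto)
        also have "\<dots> \<le> \<gamma>\<^sub>1 * sqrt (\<rho> i\<^sub>0)" using i\<^sub>0[of j] \<gamma>\<^sub>1 by (intro mult_left_mono) auto
        finally show ?thesis .
      qed
      have "\<bar>?aX - ?aY\<bar> \<le> L\<^sub>i i\<^sub>0 * norm (?lX - ?lY)"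
        using lipschitz_onD[OF L\<^sub>i, of ?lX ?lY i\<^sub>0] by (simp add: dist_norm)
      also have "\<dots> \<le> L * (\<Sum>j\<in>UNIV. \<bar>(?lX - ?lY) $ j\<bar>)"
        using L L_nonneg by (intro mult_mono norm_le_l1_cart) auto
      also have "\<dots> \<le> L * (\<Sum>j\<in>(UNIV :: 'n set). \<gamma>\<^sub>1 * sqrt (\<rho> i\<^sub>0))"
        by (intro mult_left_mono sum_mono l L_nonneg)
      finally have "\<bar>?aX - ?aY\<bar> \<le> real CARD('n) * L * \<gamma>\<^sub>1 * sqrt (\<rho> i\<^sub>0)" by (simp add: mult_ac)
      hence "\<bar>?aX - ?aY\<bar> * coeff_b2 \<gamma> ?t \<le> real CARD('n) * L * \<gamma>\<^sub>1 * sqrt (\<rho> i\<^sub>0) * (1 / \<gamma>\<^sub>0\<^sup>2)"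
        using b2(2,3)[OF n] by (intro mult_mono) auto
      thus ?thesis
        using b2(2)[OF n] by (simp add: C_def left_diff_distrib[symmetric] abs_mult)
    qed
    \<comment> \<open>\<open>D\<close> is \<open>C * sqrt (\<rho> i\<^sub>0)\<close> and
      \<open>K\<close> is \<open>sqrt E\<close>, so the right side is a multiple of
      \<open>\<rho> i\<^sub>0\<close> with the small factor \<open>\<delta>\<close>.\<close>
    have "4 * \<mu> * \<rho> i\<^sub>0 \<le> \<delta> * ((C * sqrt (\<rho> i\<^sub>0))\<^sup>2 * (sqrt E)\<^sup>2 + B\<^sup>2 * \<rho> i\<^sub>0)"
      unfolding \<rho>_def
      by (rule uniqueness_estimate[where F = "L2_inner (\<lambda>y. ?g i\<^sub>0 y (t_mid \<delta> n))",
            OF mesh fe[OF X] fe[OF Y] Vn b_cont b_bound[OF n] \<mu> b2(1)[OF n] \<delta>(1)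
            diff[unfolded \<rho>_def] hY scheme[OF X] scheme[OF Y]])
    also have "\<dots> = \<delta> * (C\<^sup>2 * E + B\<^sup>2) * \<rho> i\<^sub>0"
      using E \<rho>_nonneg[of i\<^sub>0] by (simp add: power_mult_distrib algebra_simps)
    finally have "(4 * \<mu> - \<delta> * (C\<^sup>2 * E + B\<^sup>2)) * \<rho> i\<^sub>0 \<le> 0" by (simp add: algebra_simps)
    moreover have "\<delta> * (C\<^sup>2 * E + B\<^sup>2) < 4 * \<mu>"
    proof -
      have "\<delta> * (C\<^sup>2 * E + B\<^sup>2) \<le> \<delta> * (C\<^sup>2 * E + B\<^sup>2 + 1)" using \<delta> by (intro mult_left_mono) auto
      also have "\<dots> < 4 * \<mu>"
        using \<delta> den by (simp add: \<delta>\<^sub>0_def pos_less_divide_eq[symmetric])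
      finally show ?thesis .
    qed
    ultimately have "\<rho> i\<^sub>0 \<le> 0" by (simp add: mult_le_0_iff)
    hence "\<rho> i = 0" using i\<^sub>0[of i] \<rho>_nonneg[of i] by simp
    moreover have "?e i \<in> ?S"
      using fe_space_lincomb[OF fe[OF X] fe[OF Y], of "1/2" i "-1/2" i] by (simp add: diff_divide_distrib)
    ultimately have "?e i y = 0"
      using y fe_space_norm_zero[of "?e i" k m z y] by (simp only: \<rho>_def)
    thus "X i y = Y i y" by simp
  qed
  show "\<exists>\<delta>\<^sub>0>0. \<forall>N \<delta> m z h.
      0 < \<delta> \<and> \<delta> < \<delta>\<^sub>0 \<and> real N * \<delta> = T \<and> mesh m z h \<and> c\<^sub>1 * h\<^sup>2 \<le> \<delta> \<and> \<delta> \<le> c\<^sub>2 * h\<^sup>2 \<and>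
      sampled_data_bound (\<lambda>i. rhs_g \<alpha> \<gamma> (f i)) \<delta> N G \<longrightarrow>
      (\<forall>n\<in>{1..N}. \<forall>V.
        (\<forall>i. lagrange_interpolant k \<xi> m z (init_v \<alpha> \<gamma> (u0 i)) (V 0 i)) \<and>
        (\<forall>q\<in>{1..<n}. ?step \<delta> m z q (V (q - 1)) (V q)) \<longrightarrow>
        (\<forall>X Y. ?step \<delta> m z n (V (n - 1)) X \<and> ?step \<delta> m z n (V (n - 1)) Y \<longrightarrow>
          (\<forall>i. \<forall>y\<in>{0..1}. X i y = Y i y)))"
    using \<delta>\<^sub>0 unique by (intro exI[of _ \<delta>\<^sub>0] conjI allI impI ballI) blast+
qed

end
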